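(* Let $L,\varepsilon>0$, $\sigma^2\ge0$, $n\in\mathbb{N}$. Let $f:\mathbb{R}^d\to\mathbb{R}$ be differentiable and $L$-smooth ($\|\nabla f(x)-\nabla f(y)\|\le L\|x-y\|$ for all $x,y$), with $\Delta=f(x^0)-\inf_xf(x)<\infty$, and let the stochastic gradients satisfy $\mathbb{E}_\xi[\nabla f(x;\xi)]=\nabla f(x)$ and $\mathbb{E}_\xi[\|\nabla f(x;\xi)-\nabla f(x)\|^2]\le\sigma^2$ for all $x\in\mathbb{R}^d$. Then Decaying Local SGD with $\eta_g=\min\{\frac{\varepsilon}{8L\sigma^2},\frac1{4nL}\}$, $b=\max\{\frac{\sigma^2}{\varepsilon},n\}$ and $K=\max\{\lceil\frac{\sigma^2}{\varepsilon n}\rceil,1\}$ finds an $\varepsilon$-stationary point after at most $R=\lceil\frac{32L\Delta}{\varepsilon}\rceil$ communication rounds. Additionally, if computing one stochastic gradient takes at most $h$ seconds and one communication takes at most $\tau$ seconds, it requires at most $$\tau\frac{64L\Delta}{\varepsilon}+64h\left(\frac{L\Delta}{\varepsilon}+\frac{L\sigma^2\Delta}{n\varepsilon^2}\right)$$ seconds to find an $\varepsilon$-stationary point.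
   Context: Decaying Local SGD ($n$ workers, starting point $x^0$, step size $\eta_g$, parameter $b$, $R$ communication rounds, $K$ local steps): for $t=0,\dots,R-1$, each worker $i\in\{1,\dots,n\}$ in parallel sets $z^t_{i,0}=x^t$ and performs $z^t_{i,j+1}=z^t_{i,j}-\eta_j\nabla f(z^t_{i,j};\xi^t_{i,j})$ for $j=0,\dots,K-1$, with independent samples $\xi^t_{i,j}\sim\mathcal D$ and $\eta_j=\sqrt{\frac{b}{(j+1)(\log K+1)}}\,\eta_g$ ($\log$ natural); then $x^{t+1}=x^t-\eta_g\sum_{i=1}^n\sum_{j=0}^{K-1}\nabla f(z^t_{i,j};\xi^t_{i,j})$. An $\varepsilon$-stationary point is a (possibly random) point $\bar x$, selected from the iterates $x^t$ (including $x^0$), with $\mathbb{E}[\|\nabla f(\bar x)\|^2]\le\varepsilon$. Time: workers compute in parallel, so each round takes at most $\tau+hK$ seconds. If $\sigma^2=0$, $\frac{\varepsilon}{8L\sigma^2}$ is read as $+\infty$. *)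

theory Defs
  imports "HOL-Probability.Probability"
begin

text \<open>Throughout, \<open>g x s\<close> is the stochastic gradient at \<open>x\<close> with sample \<open>s\<close>, \<open>\<xi> t i j\<close> is the sample
  used in round \<open>t\<close> by worker \<open>i\<close> (numbered from 1) in local step \<open>j\<close>, and \<open>\<eta>\<^sub>g\<close> is the global step
  size.\<close>

definition local_step_size :: "real \<Rightarrow> real \<Rightarrow> nat \<Rightarrow> nat \<Rightarrow> real" where
  "local_step_size \<eta>\<^sub>g b K j = sqrt (b / ((real j + 1) * (ln (real K) + 1))) * \<eta>\<^sub>g"

primrec local_iterate ::
  "(nat \<Rightarrow> real) \<Rightarrow> ('a::real_vector \<Rightarrow> 'x \<Rightarrow> 'a) \<Rightarrow> (nat \<Rightarrow> 'x) \<Rightarrow> 'a \<Rightarrow> nat \<Rightarrow> 'a" where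
  "local_iterate \<eta> g s x 0 = x"
| "local_iterate \<eta> g s x (Suc j) =
     local_iterate \<eta> g s x j - \<eta> j *\<^sub>R g (local_iterate \<eta> g s x j) (s j)"

primrec decaying_local_sgd ::
  "nat \<Rightarrow> nat \<Rightarrow> real \<Rightarrow> real \<Rightarrow> ('a::real_vector \<Rightarrow> 'x \<Rightarrow> 'a) \<Rightarrow> 'a
     \<Rightarrow> (nat \<Rightarrow> nat \<Rightarrow> nat \<Rightarrow> 'x) \<Rightarrow> nat \<Rightarrow> 'a" where
  "decaying_local_sgd n K \<eta>\<^sub>g b g x0 \<xi> 0 = x0"
| "decaying_local_sgd n K \<eta>\<^sub>g b g x0 \<xi> (Suc t) =
     (let x = decaying_local_sgd n K \<eta>\<^sub>g b g x0 \<xi> t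
      in x - \<eta>\<^sub>g *\<^sub>R (\<Sum>i = 1..n. \<Sum>j<K.
           g (local_iterate (local_step_size \<eta>\<^sub>g b K) g (\<xi> t i) x j) (\<xi> t i j)))"

text \<open>The expectation is taken in the extended nonnegative reals, so that the bound includes
  finiteness of the second moment.\<close>

definition eps_stationary ::
  "'w measure \<Rightarrow> ('a::euclidean_space \<Rightarrow> 'a) \<Rightarrow> real \<Rightarrow> ('w \<Rightarrow> 'a) \<Rightarrow> bool" where
  "eps_stationary M grad \<epsilon> y \<longleftrightarrow>
     y \<in> borel_measurable M \<and> (\<integral>\<^sup>+ \<omega>. ennreal ((norm (grad (y \<omega>)))\<^sup>2) \<partial>M) \<le> ennreal \<epsilon>"

text \<open>An \<open>\<epsilon>\<close>-stationary point can be selected from the first \<open>r + 1\<close> random iterates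
  \<open>X 0, \<dots>, X r\<close>. The selection may be randomized: the index is \<open>T s\<close>, where the seed \<open>s\<close> has law \<open>Q\<close>
  and is independent of the samples (product measure).\<close>

definition finds_eps_stationary ::
  "'w measure \<Rightarrow> ('a::euclidean_space \<Rightarrow> 'a) \<Rightarrow> real \<Rightarrow> (nat \<Rightarrow> 'w \<Rightarrow> 'a) \<Rightarrow> nat \<Rightarrow> bool" where
  "finds_eps_stationary M grad \<epsilon> X r \<longleftrightarrow>
     (\<exists>(Q :: nat pmf) (T :: nat \<Rightarrow> nat). (\<forall>s. T s \<le> r) \<and>
        eps_stationary (measure_pmf Q \<Otimes>\<^sub>M M) grad \<epsilon> (\<lambda>(s, \<omega>). X (T s) \<omega>))"

text \<open>Wall-clock time of \<open>r\<close> rounds: in round \<open>t\<close> the \<open>n\<close> workers compute in parallel, \<open>gtime t i j\<close>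
  being the duration of the \<open>j\<close>-th gradient computation of worker \<open>i\<close>; once the slowest one is done,
  one communication of duration \<open>ctime t\<close> follows.\<close>

definition run_time ::
  "nat \<Rightarrow> nat \<Rightarrow> (nat \<Rightarrow> nat \<Rightarrow> nat \<Rightarrow> real) \<Rightarrow> (nat \<Rightarrow> real) \<Rightarrow> nat \<Rightarrow> real" where
  "run_time n K gtime ctime r = (\<Sum>t<r. ((MAX i\<in>{1..n}. \<Sum>j<K. gtime t i j) + ctime t))"

end

theory Submission
  imports Defs
begin

text \<open>
  Write \<open>G\<^sub>t\<close> for the second moment of the gradient at the iterate of round \<open>t\<close>, and \<open>\<gamma> = \<eta>\<^sub>g * n * K\<close> for
  the effective step size of a round. If all stochastic gradients of a round were exact and taken at the
  iterate \<open>x\<close>, a round would be one gradient step of length \<open>\<gamma>\<close>, which lies between \<open>1 / (8 * L)\<close> and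
  \<open>1 / (2 * L)\<close>, and would decrease \<open>f\<close> in expectation by about \<open>\<gamma> / 2 * G\<^sub>t\<close>. Two errors spoil this.

  The first is noise. The errors of the \<open>n * K\<close> stochastic gradients of a round are pairwise
  uncorrelated, so the second moment of their sum is at most \<open>n * K * \<sigma>\<^sup>2\<close> rather than
  \<open>(n * K)\<^sup>2 * \<sigma>\<^sup>2\<close>, and their loss per round is at most \<open>\<gamma> * L * \<eta>\<^sub>g * \<sigma>\<^sup>2 \<le> \<gamma> * \<epsilon> / 8\<close>. The lemmas
  \<open>fresh_noise_uncorrelated\<close> and \<open>noise_uncorrelated\<close> are responsible for this.

  The second is drift: the gradients are taken at the local points, not at \<open>x\<close>. By \<open>local_drift\<close>, the
  resulting mean squared gradient error is at most \<open>12 / 5 * \<epsilon> / 64 + G\<^sub>t / 5\<close>. The decaying local steps serve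
  to make this possible with \<open>K\<close> local steps, because the sum of their squares is at most
  \<open>b * \<eta>\<^sub>g\<^sup>2\<close>, while their sum is of order \<open>sqrt K\<close>.

  Together (\<open>round_progress\<close>, \<open>expected_decrease\<close>) a round decreases \<open>f\<close> in expectation by at least
  \<open>\<gamma> * (2 / 5 * G\<^sub>t - 6 / 5 * \<epsilon> / 64 - \<epsilon> / 8)\<close>. Telescoping over \<open>R \<ge> 32 * L * \<Delta> / \<epsilon>\<close> rounds bounds the
  average of the \<open>G\<^sub>t\<close> by \<open>63 / 64 * \<epsilon>\<close>, and an iterate chosen uniformly at random from the first \<open>R\<close> is
  \<open>\<epsilon>\<close>-stationary.

  For the running time, \<open>R\<close> rounds with \<open>K \<le> 1 + \<sigma>\<^sup>2 / (\<epsilon> * n)\<close> local steps suffice, and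
  \<open>R \<le> 64 * L * \<Delta> / \<epsilon>\<close> unless \<open>\<Delta>\<close> is so small that \<open>x0\<close> is itself \<open>\<epsilon>\<close>-stationary
  by \<open>smooth_gradient_bound\<close>.
\<close>

section \<open>Smooth functions\<close>

text \<open>Along the segment from \<open>x\<close> to \<open>y\<close>, the difference between \<open>f\<close> and the quadratic upper model has a
  derivative that the Lipschitz bound on the gradient makes nonpositive.\<close>

lemma smooth_descent:
  fixes f :: "'a::euclidean_space \<Rightarrow> real"
  assumes gradient: "\<And>x. GDERIV f x :> grad x"
    and smooth: "\<And>x y. norm (grad x - grad y) \<le> L * norm (x - y)"
  shows "f y \<le> f x + inner (grad x) (y - x) + L / 2 * (norm (y - x))\<^sup>2"
proof -
  define d where "d = y - x"
  define h where "h t = f (x + t *\<^sub>R d) - t * inner (grad x) d - L / 2 * t\<^sup>2 * (norm d)\<^sup>2" for t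
  have f_der: "(f has_derivative (\<lambda>v. inner v (grad u))) (at u)" for u
    using gradient[of u] by (simp add: gderiv_def)
  have f_line: "((\<lambda>t. f (x + t *\<^sub>R d)) has_real_derivative inner (grad (x + t *\<^sub>R d)) d) (at t)" for t
  proof -
    have "((\<lambda>t. x + t *\<^sub>R d) has_derivative (\<lambda>s. s *\<^sub>R d)) (at t)"
      by (auto intro!: derivative_eq_intros)
    from diff_chain_at[OF this f_der]
    show ?thesis
      by (simp add: has_field_derivative_def o_def inner_commute mult.commute[of _ "inner _ _"])
  qed
  have h_der: "(h has_real_derivative
      inner (grad (x + t *\<^sub>R d)) d - inner (grad x) d - L * t * (norm d)\<^sup>2) (at t)" for t
    unfolding h_def by (rule derivative_eq_intros f_line refl | simp)+
  have "h 1 \<le> h 0"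
  proof (rule DERIV_nonpos_imp_nonincreasing[of 0 1 h])
    show "0 \<le> (1::real)" by simp
    fix t :: real assume t: "0 \<le> t" "t \<le> 1"
    have "inner (grad (x + t *\<^sub>R d) - grad x) d \<le> norm (grad (x + t *\<^sub>R d) - grad x) * norm d"
      by (rule norm_cauchy_schwarz)
    also have "\<dots> \<le> (L * norm (t *\<^sub>R d)) * norm d"
      using smooth[of "x + t *\<^sub>R d" x] by (intro mult_right_mono) simp_all
    also have "\<dots> = L * t * (norm d)\<^sup>2" using t by (simp add: power2_eq_square)
    finally show "\<exists>y. DERIV h t :> y \<and> y \<le> 0"
      using h_der[of t] by (force simp: inner_diff_left)
  qed
  then show ?thesis by (simp add: h_def d_def)
qed

text \<open>A gradient step of length \<open>1 / L\<close> decreases \<open>f\<close> by at least \<open>(norm (grad x))\<^sup>2 / (2 * L)\<close>, and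
  it cannot go below the infimum.\<close>

lemma smooth_gradient_bound:
  fixes f :: "'a::euclidean_space \<Rightarrow> real"
  assumes gradient: "\<And>x. GDERIV f x :> grad x"
    and smooth: "\<And>x y. norm (grad x - grad y) \<le> L * norm (x - y)"
    and "L > 0" and lower: "\<And>x. c \<le> f x"
  shows "(norm (grad x))\<^sup>2 \<le> 2 * L * (f x - c)"
proof -
  define y where "y = x - (1 / L) *\<^sub>R grad x"
  have "c \<le> f x + inner (grad x) (y - x) + L / 2 * (norm (y - x))\<^sup>2"
    using lower[of y] smooth_descent[OF gradient smooth, of y x] by linarith
  also have "\<dots> = f x - (norm (grad x))\<^sup>2 / (2 * L)"
    using \<open>L > 0\<close> by (simp add: y_def power_divide dot_square_norm field_simps power2_eq_square[of L])
  finally show ?thesis using \<open>L > 0\<close> by (simp add: field_simps)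
qed

lemma lipschitz_borel_measurable:
  fixes h :: "'a::euclidean_space \<Rightarrow> 'a"
  assumes "L > 0" and "\<And>x y. norm (h x - h y) \<le> L * norm (x - y)"
  shows "h \<in> borel_measurable borel"
proof -
  have "L-lipschitz_on UNIV h"
    using assms by (auto intro!: lipschitz_onI simp: dist_norm)
  then show ?thesis
    by (intro borel_measurable_continuous_onI lipschitz_on_continuous_on)
qed

lemma gderiv_borel_measurable:
  fixes f :: "'a::euclidean_space \<Rightarrow> real"
  assumes "\<And>x. GDERIV f x :> grad x"
  shows "f \<in> borel_measurable borel"
  using assms
  by (intro borel_measurable_continuous_onI continuous_at_imp_continuous_on ballI)
     (metis gderiv_def has_derivative_continuous)

section \<open>Square-integrable random vectors\<close>

definition sq_integrable :: "'w measure \<Rightarrow> ('w \<Rightarrow> 'a::euclidean_space) \<Rightarrow> bool" where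
  "sq_integrable M X \<longleftrightarrow> X \<in> borel_measurable M \<and> integrable M (\<lambda>\<omega>. (norm (X \<omega>))\<^sup>2)"

lemma norm_add_square_le: "(norm (x + y))\<^sup>2 \<le> 2 * (norm x)\<^sup>2 + 2 * (norm y)\<^sup>2"
  for x y :: "'a::real_inner"
proof -
  have "2 * (norm x)\<^sup>2 + 2 * (norm y)\<^sup>2 - (norm (x + y))\<^sup>2 = (norm (x - y))\<^sup>2"
    by (simp add: power2_norm_eq_inner algebra_simps inner_commute)
  then show ?thesis using zero_le_power2[of "norm (x - y)"] by linarith
qed

lemma sq_integrable_measurable: "sq_integrable M X \<Longrightarrow> X \<in> borel_measurable M"
  by (simp add: sq_integrable_def)

lemma sq_integrable_norm: "sq_integrable M X \<Longrightarrow> integrable M (\<lambda>\<omega>. (norm (X \<omega>))\<^sup>2)"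
  by (simp add: sq_integrable_def)

lemma sq_integrable_add:
  assumes "sq_integrable M X" "sq_integrable M Y"
  shows "sq_integrable M (\<lambda>\<omega>. X \<omega> + Y \<omega>)"
proof -
  have [measurable]: "X \<in> borel_measurable M" "Y \<in> borel_measurable M"
    using assms by (simp_all add: sq_integrable_def)
  have "integrable M (\<lambda>\<omega>. 2 * (norm (X \<omega>))\<^sup>2 + 2 * (norm (Y \<omega>))\<^sup>2)"
    using assms by (simp add: sq_integrable_def)
  then have "integrable M (\<lambda>\<omega>. (norm (X \<omega> + Y \<omega>))\<^sup>2)"
    by (rule Bochner_Integration.integrable_bound)
       (simp_all add: norm_add_square_le)
  then show ?thesis by (simp add: sq_integrable_def)
qed

lemma sq_integrable_scaleR:
  "sq_integrable M X \<Longrightarrow> sq_integrable M (\<lambda>\<omega>. c *\<^sub>R X \<omega>)"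
  unfolding sq_integrable_def by (auto simp: power_mult_distrib intro: borel_measurable_scaleR)

lemma sq_integrable_diff:
  assumes "sq_integrable M X" "sq_integrable M Y"
  shows "sq_integrable M (\<lambda>\<omega>. X \<omega> - Y \<omega>)"
  using sq_integrable_add[OF assms(1) sq_integrable_scaleR[OF assms(2), of "- 1"]] by simp

lemma sq_integrable_zero: "sq_integrable M (\<lambda>_. 0)"
  by (simp add: sq_integrable_def)

lemma sq_integrable_sum:
  assumes "\<And>i. i \<in> A \<Longrightarrow> sq_integrable M (X i)"
  shows "sq_integrable M (\<lambda>\<omega>. \<Sum>i\<in>A. X i \<omega>)"
  using assms
  by (induction A rule: infinite_finite_induct) (simp_all add: sq_integrable_zero sq_integrable_add)

lemma sq_integrable_inner:
  assumes "sq_integrable M X" "sq_integrable M Y"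
  shows "integrable M (\<lambda>\<omega>. inner (X \<omega>) (Y \<omega>))"
proof -
  have [measurable]: "X \<in> borel_measurable M" "Y \<in> borel_measurable M"
    using assms by (simp_all add: sq_integrable_def)
  have "integrable M (\<lambda>\<omega>. (norm (X \<omega>))\<^sup>2 + (norm (Y \<omega>))\<^sup>2)"
    using assms by (simp add: sq_integrable_def)
  then show ?thesis
  proof (rule Bochner_Integration.integrable_bound)
    have "\<bar>inner x y\<bar> \<le> (norm x)\<^sup>2 + (norm y)\<^sup>2" for x y :: 'b
    proof -
      have "\<bar>inner x y\<bar> \<le> norm x * norm y" by (rule Cauchy_Schwarz_ineq2)
      moreover have "2 * (norm x * norm y) \<le> (norm x)\<^sup>2 + (norm y)\<^sup>2"
        using sum_squares_bound[of "norm x" "norm y"] by simp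
      moreover have "0 \<le> norm x * norm y" by simp
      ultimately show ?thesis by linarith
    qed
    then show "AE \<omega> in M. norm (inner (X \<omega>) (Y \<omega>)) \<le> norm ((norm (X \<omega>))\<^sup>2 + (norm (Y \<omega>))\<^sup>2)"
      by simp
  qed measurable
qed

lemma (in finite_measure) sq_integrable_const: "sq_integrable M (\<lambda>_. c)"
  by (simp add: sq_integrable_def)

lemma (in finite_measure) sq_integrable_lipschitz:
  fixes h :: "'b::euclidean_space \<Rightarrow> 'b"
  assumes X: "sq_integrable M X" and "L > 0" and h: "\<And>x y. norm (h x - h y) \<le> L * norm (x - y)"
  shows "sq_integrable M (\<lambda>\<omega>. h (X \<omega>))"
proof -
  have [measurable]: "X \<in> borel_measurable M" "h \<in> borel_measurable borel"
    using X lipschitz_borel_measurable[OF \<open>L > 0\<close> h] by (simp_all add: sq_integrable_def)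
  have le: "(norm (h x - h 0))\<^sup>2 \<le> L\<^sup>2 * (norm x)\<^sup>2" for x
    using power_mono[OF h[of x 0], of 2] by (simp add: power_mult_distrib)
  have "integrable M (\<lambda>\<omega>. L\<^sup>2 * (norm (X \<omega>))\<^sup>2)"
    using X by (simp add: sq_integrable_def)
  then have "integrable M (\<lambda>\<omega>. (norm (h (X \<omega>) - h 0))\<^sup>2)"
  proof (rule Bochner_Integration.integrable_bound)
    show "AE \<omega> in M. norm ((norm (h (X \<omega>) - h 0))\<^sup>2) \<le> norm (L\<^sup>2 * (norm (X \<omega>))\<^sup>2)"
      using le by (intro always_eventually) (simp add: abs_mult)
  qed measurable
  then have "sq_integrable M (\<lambda>\<omega>. h (X \<omega>) - h 0)" by (simp add: sq_integrable_def)
  from sq_integrable_add[OF this sq_integrable_const[of "h 0"]] show ?thesis by simp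
qed

text \<open>For pairwise uncorrelated vectors all cross terms of the squared norm vanish.\<close>

lemma second_moment_sum_orthogonal:
  assumes "finite A"
    and sq: "\<And>i. i \<in> A \<Longrightarrow> sq_integrable M (V i)"
    and orth: "\<And>i j. i \<in> A \<Longrightarrow> j \<in> A \<Longrightarrow> i \<noteq> j \<Longrightarrow> (\<integral>\<omega>. inner (V i \<omega>) (V j \<omega>) \<partial>M) = 0"
  shows "(\<integral>\<omega>. (norm (\<Sum>i\<in>A. c i *\<^sub>R V i \<omega>))\<^sup>2 \<partial>M) = (\<Sum>i\<in>A. (c i)\<^sup>2 * (\<integral>\<omega>. (norm (V i \<omega>))\<^sup>2 \<partial>M))"
proof -
  have int: "integrable M (\<lambda>\<omega>. inner (V i \<omega>) (V j \<omega>))" if "i \<in> A" "j \<in> A" for i j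
    using that sq by (intro sq_integrable_inner)
  have "(\<integral>\<omega>. (norm (\<Sum>i\<in>A. c i *\<^sub>R V i \<omega>))\<^sup>2 \<partial>M)
      = (\<integral>\<omega>. (\<Sum>i\<in>A. \<Sum>j\<in>A. c i * c j * inner (V i \<omega>) (V j \<omega>)) \<partial>M)"
    by (simp add: power2_norm_eq_inner inner_sum_left inner_sum_right sum_distrib_left mult_ac
        inner_commute)
  also have "\<dots> = (\<Sum>i\<in>A. \<Sum>j\<in>A. c i * c j * (\<integral>\<omega>. inner (V i \<omega>) (V j \<omega>) \<partial>M))"
    by (simp add: Bochner_Integration.integral_sum Bochner_Integration.integrable_sum int)
  also have "\<dots> = (\<Sum>i\<in>A. \<Sum>j\<in>A. if j = i then c i * c i * (\<integral>\<omega>. inner (V i \<omega>) (V i \<omega>) \<partial>M) else 0)"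
    by (intro sum.cong refl) (auto simp: orth)
  also have "\<dots> = (\<Sum>i\<in>A. (c i)\<^sup>2 * (\<integral>\<omega>. (norm (V i \<omega>))\<^sup>2 \<partial>M))"
    using \<open>finite A\<close> by (simp add: power2_norm_eq_inner power2_eq_square[of "c _"])
  finally show ?thesis .
qed

text \<open>Cauchy--Schwarz applied to \<open>sqrt (c i)\<close> and \<open>sqrt (c i) * norm (v i)\<close>. The weights are kept inside the
  second factor because the local step sizes are not constant: only their sum, which grows like
  \<open>sqrt K\<close>, then has to be small.\<close>

lemma norm_weighted_sum_square_le:
  fixes v :: "'i \<Rightarrow> 'a::real_normed_vector"
  assumes "\<And>i. i \<in> A \<Longrightarrow> 0 \<le> c i"
  shows "(norm (\<Sum>i\<in>A. c i *\<^sub>R v i))\<^sup>2 \<le> (\<Sum>i\<in>A. c i) * (\<Sum>i\<in>A. c i * (norm (v i))\<^sup>2)"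
proof -
  have "norm (\<Sum>i\<in>A. c i *\<^sub>R v i) \<le> (\<Sum>i\<in>A. sqrt (c i) * (sqrt (c i) * norm (v i)))"
    by (rule sum_norm_le) (simp add: assms mult.assoc[symmetric])
  then have "(norm (\<Sum>i\<in>A. c i *\<^sub>R v i))\<^sup>2 \<le> (\<Sum>i\<in>A. sqrt (c i) * (sqrt (c i) * norm (v i)))\<^sup>2"
    by (rule power_mono) simp
  also have "\<dots> \<le> (\<Sum>i\<in>A. (sqrt (c i))\<^sup>2) * (\<Sum>i\<in>A. (sqrt (c i) * norm (v i))\<^sup>2)"
    by (rule Cauchy_Schwarz_ineq_sum)
  also have "\<dots> = (\<Sum>i\<in>A. c i) * (\<Sum>i\<in>A. c i * (norm (v i))\<^sup>2)"
    by (simp add: assms power_mult_distrib)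
  finally show ?thesis .
qed

section \<open>Drift of a worker and progress of a round\<close>

context prob_space
begin

text \<open>The drift \<open>z j - z 0\<close> is minus a weighted sum of the gradients at the earlier local points plus
  a weighted sum of uncorrelated noises. The noise part contributes only through the sum of squares of
  the step sizes. Each gradient in the first part differs from \<open>grad (z 0)\<close> by at most \<open>L\<close> times an
  earlier drift, so the bound is proved by strong induction on \<open>j\<close>. The claimed bound \<open>C\<close> is the
  fixed point of \<open>C = 2 * \<beta> + (G + C) / 6\<close>, where \<open>G\<close> is the second moment of \<open>grad (z 0)\<close> and
  \<open>1 / 6\<close> is four times the assumed \<open>1 / 24\<close>: two factors \<open>2\<close> come from splitting squared norms of
  sums. A bound whose coefficient of \<open>G\<close> is well below \<open>1\<close> is essential, since the drift is charged
  against the decrease that the gradient at the start of the round provides.\<close>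

lemma local_drift:
  fixes grad :: "'b::euclidean_space \<Rightarrow> 'b" and z \<zeta> :: "nat \<Rightarrow> 'a \<Rightarrow> 'b" and \<eta> :: "nat \<Rightarrow> real"
  assumes "L > 0" and smooth: "\<And>x y. norm (grad x - grad y) \<le> L * norm (x - y)"
    and step: "\<And>j \<omega>. j < m \<Longrightarrow> z (Suc j) \<omega> = z j \<omega> - \<eta> j *\<^sub>R (grad (z j \<omega>) + \<zeta> j \<omega>)"
    and z: "\<And>j. j \<le> m \<Longrightarrow> sq_integrable M (z j)"
    and \<zeta>: "\<And>j. j < m \<Longrightarrow> sq_integrable M (\<zeta> j)"
    and orth: "\<And>i j. i < m \<Longrightarrow> j < m \<Longrightarrow> i \<noteq> j \<Longrightarrow> expectation (\<lambda>\<omega>. inner (\<zeta> i \<omega>) (\<zeta> j \<omega>)) = 0"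
    and var: "\<And>j. j < m \<Longrightarrow> expectation (\<lambda>\<omega>. (norm (\<zeta> j \<omega>))\<^sup>2) \<le> s"
    and \<eta>: "\<And>j. 0 \<le> \<eta> j"
    and sum_small: "L\<^sup>2 * (\<Sum>l<m. \<eta> l)\<^sup>2 \<le> 1 / 24"
    and noise_small: "L\<^sup>2 * s * (\<Sum>l<m. (\<eta> l)\<^sup>2) \<le> \<beta>"
    and "0 \<le> s" and "j \<le> m"
  shows "L\<^sup>2 * expectation (\<lambda>\<omega>. (norm (z j \<omega> - z 0 \<omega>))\<^sup>2)
    \<le> 12 / 5 * \<beta> + 1 / 5 * expectation (\<lambda>\<omega>. (norm (grad (z 0 \<omega>)))\<^sup>2)"
  using \<open>j \<le> m\<close>
proof (induction j rule: less_induct)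
  case (less j)
  define G where "G = expectation (\<lambda>\<omega>. (norm (grad (z 0 \<omega>)))\<^sup>2)"
  define C where "C = 12 / 5 * \<beta> + 1 / 5 * G"
  define D where "D l = expectation (\<lambda>\<omega>. (norm (z l \<omega> - z 0 \<omega>))\<^sup>2)" for l
  define S where "S = (\<Sum>l<j. \<eta> l)"
  have G0: "0 \<le> G" unfolding G_def by (rule Bochner_Integration.integral_nonneg) simp
  have grad_sq: "sq_integrable M (\<lambda>\<omega>. grad (z l \<omega>))" if "l \<le> m" for l
    by (rule sq_integrable_lipschitz[OF z[OF that] \<open>L > 0\<close> smooth])
  have diff_sq: "sq_integrable M (\<lambda>\<omega>. z l \<omega> - z 0 \<omega>)" if "l \<le> m" for l
    using that by (intro sq_integrable_diff z) auto
  have telescope: "z i \<omega> - z 0 \<omega> = - ((\<Sum>l<i. \<eta> l *\<^sub>R grad (z l \<omega>)) + (\<Sum>l<i. \<eta> l *\<^sub>R \<zeta> l \<omega>))"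
    if "i \<le> m" for i \<omega>
    using that by (induction i) (auto simp: step algebra_simps)
  have S0: "0 \<le> S" by (simp add: S_def \<eta> sum_nonneg)
  have S_le: "S \<le> (\<Sum>l<m. \<eta> l)"
    unfolding S_def using less.prems by (intro sum_mono2) (auto simp: \<eta>)
  have LS: "L\<^sup>2 * S\<^sup>2 \<le> 1 / 24"
    using mult_left_mono[OF power_mono[OF S_le S0, of 2], of "L\<^sup>2"] sum_small by simp
  have pointwise: "(norm (z j \<omega> - z 0 \<omega>))\<^sup>2
      \<le> 2 * (norm (\<Sum>l<j. \<eta> l *\<^sub>R \<zeta> l \<omega>))\<^sup>2
        + 4 * S * (\<Sum>l<j. \<eta> l * ((norm (grad (z 0 \<omega>)))\<^sup>2 + L\<^sup>2 * (norm (z l \<omega> - z 0 \<omega>))\<^sup>2))" for \<omega>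
  proof -
    have "(\<Sum>l<j. \<eta> l * (norm (grad (z l \<omega>)))\<^sup>2)
        \<le> (\<Sum>l<j. \<eta> l * (2 * (norm (grad (z 0 \<omega>)))\<^sup>2 + 2 * (L\<^sup>2 * (norm (z l \<omega> - z 0 \<omega>))\<^sup>2)))"
    proof (intro sum_mono mult_left_mono \<eta>)
      fix l
      have "(norm (grad (z l \<omega>)))\<^sup>2
          \<le> 2 * (norm (grad (z 0 \<omega>)))\<^sup>2 + 2 * (norm (grad (z l \<omega>) - grad (z 0 \<omega>)))\<^sup>2"
        using norm_add_square_le[of "grad (z 0 \<omega>)" "grad (z l \<omega>) - grad (z 0 \<omega>)"] by simp
      also have "(norm (grad (z l \<omega>) - grad (z 0 \<omega>)))\<^sup>2 \<le> L\<^sup>2 * (norm (z l \<omega> - z 0 \<omega>))\<^sup>2"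
        using power_mono[OF smooth[of "z l \<omega>" "z 0 \<omega>"], of 2] by (simp add: power_mult_distrib)
      finally show "(norm (grad (z l \<omega>)))\<^sup>2
          \<le> 2 * (norm (grad (z 0 \<omega>)))\<^sup>2 + 2 * (L\<^sup>2 * (norm (z l \<omega> - z 0 \<omega>))\<^sup>2)" by simp
    qed
    also have "\<dots> = 2 * (\<Sum>l<j. \<eta> l * ((norm (grad (z 0 \<omega>)))\<^sup>2 + L\<^sup>2 * (norm (z l \<omega> - z 0 \<omega>))\<^sup>2))"
      by (simp add: sum_distrib_left algebra_simps)
    finally have grads: "(\<Sum>l<j. \<eta> l * (norm (grad (z l \<omega>)))\<^sup>2)
        \<le> 2 * (\<Sum>l<j. \<eta> l * ((norm (grad (z 0 \<omega>)))\<^sup>2 + L\<^sup>2 * (norm (z l \<omega> - z 0 \<omega>))\<^sup>2))" .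
    have "(norm (z j \<omega> - z 0 \<omega>))\<^sup>2
        = (norm ((\<Sum>l<j. \<eta> l *\<^sub>R grad (z l \<omega>)) + (\<Sum>l<j. \<eta> l *\<^sub>R \<zeta> l \<omega>)))\<^sup>2"
      by (subst telescope[OF less.prems]) (simp only: norm_minus_cancel)
    also have "\<dots> \<le> 2 * (norm (\<Sum>l<j. \<eta> l *\<^sub>R grad (z l \<omega>)))\<^sup>2 + 2 * (norm (\<Sum>l<j. \<eta> l *\<^sub>R \<zeta> l \<omega>))\<^sup>2"
      by (rule norm_add_square_le)
    also have "(norm (\<Sum>l<j. \<eta> l *\<^sub>R grad (z l \<omega>)))\<^sup>2 \<le> S * (\<Sum>l<j. \<eta> l * (norm (grad (z l \<omega>)))\<^sup>2)"
      unfolding S_def by (rule norm_weighted_sum_square_le) (rule \<eta>)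
    also have "S * (\<Sum>l<j. \<eta> l * (norm (grad (z l \<omega>)))\<^sup>2)
        \<le> S * (2 * (\<Sum>l<j. \<eta> l * ((norm (grad (z 0 \<omega>)))\<^sup>2 + L\<^sup>2 * (norm (z l \<omega> - z 0 \<omega>))\<^sup>2)))"
      by (rule mult_left_mono[OF grads S0])
    finally show ?thesis by (simp add: mult.assoc)
  qed
  have noise: "L\<^sup>2 * expectation (\<lambda>\<omega>. (norm (\<Sum>l<j. \<eta> l *\<^sub>R \<zeta> l \<omega>))\<^sup>2) \<le> \<beta>"
  proof -
    have "expectation (\<lambda>\<omega>. (norm (\<Sum>l<j. \<eta> l *\<^sub>R \<zeta> l \<omega>))\<^sup>2)
        = (\<Sum>l<j. (\<eta> l)\<^sup>2 * expectation (\<lambda>\<omega>. (norm (\<zeta> l \<omega>))\<^sup>2))"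
      using less.prems by (intro second_moment_sum_orthogonal \<zeta> orth) auto
    also have "\<dots> \<le> (\<Sum>l<j. (\<eta> l)\<^sup>2 * s)"
      using less.prems by (intro sum_mono mult_left_mono var) auto
    also have "\<dots> \<le> (\<Sum>l<m. (\<eta> l)\<^sup>2 * s)"
      using less.prems \<open>0 \<le> s\<close> by (intro sum_mono2) auto
    finally have "L\<^sup>2 * expectation (\<lambda>\<omega>. (norm (\<Sum>l<j. \<eta> l *\<^sub>R \<zeta> l \<omega>))\<^sup>2) \<le> L\<^sup>2 * (\<Sum>l<m. (\<eta> l)\<^sup>2 * s)"
      by (rule mult_left_mono) simp
    also have "\<dots> = L\<^sup>2 * s * (\<Sum>l<m. (\<eta> l)\<^sup>2)"
      by (simp add: sum_distrib_right[symmetric])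
    finally show ?thesis using noise_small by linarith
  qed
  have int_noise: "integrable M (\<lambda>\<omega>. (norm (\<Sum>l<j. \<eta> l *\<^sub>R \<zeta> l \<omega>))\<^sup>2)"
    using less.prems by (intro sq_integrable_norm sq_integrable_sum sq_integrable_scaleR \<zeta>) auto
  have int_term: "integrable M (\<lambda>\<omega>. (norm (grad (z 0 \<omega>)))\<^sup>2 + L\<^sup>2 * (norm (z l \<omega> - z 0 \<omega>))\<^sup>2)"
    and E_term: "expectation (\<lambda>\<omega>. (norm (grad (z 0 \<omega>)))\<^sup>2 + L\<^sup>2 * (norm (z l \<omega> - z 0 \<omega>))\<^sup>2) = G + L\<^sup>2 * D l"
    if "l < j" for l
    using that less.prems sq_integrable_norm[OF grad_sq[of 0]] sq_integrable_norm[OF diff_sq[of l]]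
    by (simp_all add: G_def D_def)
  have IH: "L\<^sup>2 * D l \<le> C" if "l < j" for l
    using less.IH[OF that] that less.prems by (simp add: D_def C_def G_def)
  have "D j \<le> expectation (\<lambda>\<omega>. 2 * (norm (\<Sum>l<j. \<eta> l *\<^sub>R \<zeta> l \<omega>))\<^sup>2
        + 4 * S * (\<Sum>l<j. \<eta> l * ((norm (grad (z 0 \<omega>)))\<^sup>2 + L\<^sup>2 * (norm (z l \<omega> - z 0 \<omega>))\<^sup>2)))"
    unfolding D_def using less.prems
    by (intro integral_mono sq_integrable_norm diff_sq pointwise Bochner_Integration.integrable_add
          integrable_mult_right Bochner_Integration.integrable_sum int_noise int_term) auto
  also have "\<dots> = 2 * expectation (\<lambda>\<omega>. (norm (\<Sum>l<j. \<eta> l *\<^sub>R \<zeta> l \<omega>))\<^sup>2)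
        + 4 * S * (\<Sum>l<j. \<eta> l * (G + L\<^sup>2 * D l))"
    by (subst Bochner_Integration.integral_add)
       (auto intro!: integrable_mult_right Bochner_Integration.integrable_sum int_noise int_term
          simp: Bochner_Integration.integral_sum int_term E_term)
  also have "(\<Sum>l<j. \<eta> l * (G + L\<^sup>2 * D l)) \<le> (\<Sum>l<j. \<eta> l * (G + C))"
    using IH by (intro sum_mono mult_left_mono \<eta>) simp
  also have "\<dots> = S * (G + C)" by (simp add: S_def sum_distrib_right)
  finally have "D j \<le> 2 * expectation (\<lambda>\<omega>. (norm (\<Sum>l<j. \<eta> l *\<^sub>R \<zeta> l \<omega>))\<^sup>2) + 4 * S * (S * (G + C))"
    using S0 by (simp add: mult_left_mono)
  then have "L\<^sup>2 * D j \<le> L\<^sup>2 * (2 * expectation (\<lambda>\<omega>. (norm (\<Sum>l<j. \<eta> l *\<^sub>R \<zeta> l \<omega>))\<^sup>2) + 4 * S * (S * (G + C)))"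
    by (rule mult_left_mono) simp
  also have "\<dots> = 2 * (L\<^sup>2 * expectation (\<lambda>\<omega>. (norm (\<Sum>l<j. \<eta> l *\<^sub>R \<zeta> l \<omega>))\<^sup>2)) + 4 * (L\<^sup>2 * S\<^sup>2 * (G + C))"
    by (simp add: algebra_simps power2_eq_square)
  also have "L\<^sup>2 * S\<^sup>2 * (G + C) \<le> 1 / 24 * (G + C)"
  proof (rule mult_right_mono[OF LS])
    have "0 \<le> L\<^sup>2 * s * (\<Sum>l<m. (\<eta> l)\<^sup>2)"
      using \<open>0 \<le> s\<close> by (simp add: sum_nonneg)
    then show "0 \<le> G + C" using G0 noise_small by (simp add: C_def)
  qed
  also have "2 * (L\<^sup>2 * expectation (\<lambda>\<omega>. (norm (\<Sum>l<j. \<eta> l *\<^sub>R \<zeta> l \<omega>))\<^sup>2)) \<le> 2 * \<beta>"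
    using noise by simp
  finally have "L\<^sup>2 * D j \<le> 2 * \<beta> + 4 * (1 / 24 * (G + C))" by simp
  also have "\<dots> = C" by (simp add: C_def field_simps)
  finally have "L\<^sup>2 * D j \<le> C" .
  then show ?case by (simp only: D_def C_def G_def)
qed

text \<open>The lower bound \<open>c\<close> and the quadratic upper model at \<open>0\<close> enclose \<open>f\<close> between two integrable
  functions.\<close>

lemma smooth_comp_integrable:
  fixes f :: "'b::euclidean_space \<Rightarrow> real"
  assumes gradient: "\<And>x. GDERIV f x :> grad x"
    and smooth: "\<And>x y. norm (grad x - grad y) \<le> L * norm (x - y)"
    and lower: "\<And>x. c \<le> f x" and X: "sq_integrable M X"
  shows "integrable M (\<lambda>\<omega>. f (X \<omega>))"
proof -
  have [measurable]: "X \<in> borel_measurable M" "f \<in> borel_measurable borel"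
    using X gderiv_borel_measurable[OF gradient] by (simp_all add: sq_integrable_def)
  let ?B = "\<lambda>\<omega>. \<bar>c\<bar> + \<bar>f 0 + inner (grad 0) (X \<omega>) + L / 2 * (norm (X \<omega>))\<^sup>2\<bar>"
  have "integrable M (\<lambda>\<omega>. inner (grad 0) (X \<omega>))"
    using sq_integrable_inner[OF sq_integrable_const X] .
  then have "integrable M ?B" using sq_integrable_norm[OF X] by simp
  then show ?thesis
  proof (rule Bochner_Integration.integrable_bound)
    have "\<bar>f (X \<omega>)\<bar> \<le> ?B \<omega>" for \<omega>
      using smooth_descent[OF gradient smooth, of "X \<omega>" 0] lower[of "X \<omega>"] by simp
    then show "AE \<omega> in M. norm (f (X \<omega>)) \<le> norm (?B \<omega>)" by simp
  qed measurable
qed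

text \<open>Insert \<open>x'\<close> into the quadratic upper model at \<open>x\<close> and write \<open>v\<close> and \<open>w\<close> for the sums of the gradients
  and of the noises. The part of the linear term in \<open>w\<close> vanishes in expectation. The quadratic term splits
  into \<open>(norm v)\<^sup>2\<close>, which the smallness of \<open>\<eta>\<close> allows to complete the square with the linear term in
  \<open>v\<close>, and \<open>(norm w)\<^sup>2\<close>, whose expectation grows only linearly in \<open>card P\<close>. The
  factor \<open>2\<close> of this splitting absorbs the correlation of \<open>v\<close> and \<open>w\<close>, which is not zero: later local
  points depend on earlier noise.\<close>

lemma round_progress:
  fixes f :: "'b::euclidean_space \<Rightarrow> real" and x x' :: "'a \<Rightarrow> 'b" and z \<zeta> :: "'p \<Rightarrow> 'a \<Rightarrow> 'b"
  assumes gradient: "\<And>x. GDERIV f x :> grad x"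
    and smooth: "\<And>x y. norm (grad x - grad y) \<le> L * norm (x - y)"
    and "L > 0" and lower: "\<And>x. c \<le> f x" and "finite P"
    and x: "sq_integrable M x" and z: "\<And>p. p \<in> P \<Longrightarrow> sq_integrable M (z p)"
    and \<zeta>: "\<And>p. p \<in> P \<Longrightarrow> sq_integrable M (\<zeta> p)"
    and step: "\<And>\<omega>. x' \<omega> = x \<omega> - \<eta> *\<^sub>R (\<Sum>p\<in>P. grad (z p \<omega>) + \<zeta> p \<omega>)"
    and centered: "\<And>p. p \<in> P \<Longrightarrow> expectation (\<lambda>\<omega>. inner (grad (x \<omega>)) (\<zeta> p \<omega>)) = 0"
    and orth: "\<And>p q. p \<in> P \<Longrightarrow> q \<in> P \<Longrightarrow> p \<noteq> q \<Longrightarrow> expectation (\<lambda>\<omega>. inner (\<zeta> p \<omega>) (\<zeta> q \<omega>)) = 0"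
    and var: "\<And>p. p \<in> P \<Longrightarrow> expectation (\<lambda>\<omega>. (norm (\<zeta> p \<omega>))\<^sup>2) \<le> s"
    and drift: "\<And>p. p \<in> P \<Longrightarrow> L\<^sup>2 * expectation (\<lambda>\<omega>. (norm (z p \<omega> - x \<omega>))\<^sup>2) \<le> C"
    and "0 \<le> \<eta>" and \<eta>: "L * \<eta> * real (card P) \<le> 1 / 2"
  shows "expectation (\<lambda>\<omega>. f (x' \<omega>)) \<le> expectation (\<lambda>\<omega>. f (x \<omega>))
    + \<eta> * real (card P) * ((C - expectation (\<lambda>\<omega>. (norm (grad (x \<omega>)))\<^sup>2)) / 2 + L * \<eta> * s)"
proof -
  define N where "N = real (card P)"
  define G where "G = expectation (\<lambda>\<omega>. (norm (grad (x \<omega>)))\<^sup>2)"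
  have grad_x: "sq_integrable M (\<lambda>\<omega>. grad (x \<omega>))"
    by (rule sq_integrable_lipschitz[OF x \<open>L > 0\<close> smooth])
  have grad_z: "sq_integrable M (\<lambda>\<omega>. grad (z p \<omega>))" if "p \<in> P" for p
    by (rule sq_integrable_lipschitz[OF z[OF that] \<open>L > 0\<close> smooth])
  have x': "sq_integrable M x'"
    unfolding step by (intro sq_integrable_diff x sq_integrable_scaleR sq_integrable_sum
        sq_integrable_add grad_z \<zeta>)
  have pointwise: "f (x' \<omega>) \<le> f (x \<omega>)
      + \<eta> / 2 * (\<Sum>p\<in>P. L\<^sup>2 * (norm (z p \<omega> - x \<omega>))\<^sup>2 - (norm (grad (x \<omega>)))\<^sup>2)
      - \<eta> * (\<Sum>p\<in>P. inner (grad (x \<omega>)) (\<zeta> p \<omega>))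
      + L * \<eta>\<^sup>2 * (norm (\<Sum>p\<in>P. 1 *\<^sub>R \<zeta> p \<omega>))\<^sup>2" for \<omega>
  proof -
    define a where "a = grad (x \<omega>)"
    define v where "v = (\<Sum>p\<in>P. grad (z p \<omega>))"
    define w where "w = (\<Sum>p\<in>P. \<zeta> p \<omega>)"
    have d: "x' \<omega> - x \<omega> = - (\<eta> *\<^sub>R (v + w))" by (simp add: step v_def w_def sum.distrib)
    have d2: "(norm (x' \<omega> - x \<omega>))\<^sup>2 = \<eta>\<^sup>2 * (norm (v + w))\<^sup>2"
      by (simp only: d norm_minus_cancel norm_scaleR power_mult_distrib power2_abs)
    have "f (x' \<omega>) \<le> f (x \<omega>) + inner a (x' \<omega> - x \<omega>) + L / 2 * (norm (x' \<omega> - x \<omega>))\<^sup>2"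
      unfolding a_def by (rule smooth_descent[OF gradient smooth])
    also have "\<dots> = f (x \<omega>) - \<eta> * inner a v - \<eta> * inner a w + L * \<eta>\<^sup>2 / 2 * (norm (v + w))\<^sup>2"
      unfolding d2 unfolding d by (simp add: inner_add_right algebra_simps)
    also have "\<dots> \<le> f (x \<omega>) - \<eta> * inner a v - \<eta> * inner a w
        + L * \<eta>\<^sup>2 / 2 * (2 * (norm v)\<^sup>2 + 2 * (norm w)\<^sup>2)"
      using \<open>L > 0\<close> by (intro add_left_mono mult_left_mono norm_add_square_le) simp
    also have "\<dots> = f (x \<omega>) - \<eta> * inner a v + L * \<eta>\<^sup>2 * (norm v)\<^sup>2 - \<eta> * inner a w + L * \<eta>\<^sup>2 * (norm w)\<^sup>2"
      by (simp add: algebra_simps)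
    also have "L * \<eta>\<^sup>2 * (norm v)\<^sup>2 \<le> \<eta> / 2 * (\<Sum>p\<in>P. (norm (grad (z p \<omega>)))\<^sup>2)"
    proof -
      have "(norm v)\<^sup>2 \<le> N * (\<Sum>p\<in>P. (norm (grad (z p \<omega>)))\<^sup>2)"
        using norm_weighted_sum_square_le[of P "\<lambda>_. 1" "\<lambda>p. grad (z p \<omega>)"] by (simp add: v_def N_def)
      then have "L * \<eta>\<^sup>2 * (norm v)\<^sup>2 \<le> L * \<eta>\<^sup>2 * (N * (\<Sum>p\<in>P. (norm (grad (z p \<omega>)))\<^sup>2))"
        using \<open>L > 0\<close> by (intro mult_left_mono) simp_all
      also have "\<dots> = \<eta> * (L * \<eta> * N) * (\<Sum>p\<in>P. (norm (grad (z p \<omega>)))\<^sup>2)"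
        by (simp add: power2_eq_square)
      also have "\<dots> \<le> \<eta> * (1 / 2) * (\<Sum>p\<in>P. (norm (grad (z p \<omega>)))\<^sup>2)"
        using \<eta> \<open>0 \<le> \<eta>\<close> by (intro mult_right_mono mult_left_mono) (simp_all add: N_def sum_nonneg)
      finally show ?thesis by simp
    qed
    also have "f (x \<omega>) - \<eta> * inner a v + \<eta> / 2 * (\<Sum>p\<in>P. (norm (grad (z p \<omega>)))\<^sup>2)
        = f (x \<omega>) + \<eta> / 2 * (\<Sum>p\<in>P. (norm (grad (z p \<omega>) - a))\<^sup>2 - (norm a)\<^sup>2)"
    proof -
      have "(\<Sum>p\<in>P. (norm (grad (z p \<omega>) - a))\<^sup>2 - (norm a)\<^sup>2)
          = (\<Sum>p\<in>P. (norm (grad (z p \<omega>)))\<^sup>2 - 2 * inner a (grad (z p \<omega>)))"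
        by (intro sum.cong refl) (simp add: power2_norm_eq_inner inner_diff_left inner_diff_right inner_commute)
      also have "\<dots> = (\<Sum>p\<in>P. (norm (grad (z p \<omega>)))\<^sup>2) - 2 * inner a v"
        by (simp add: v_def sum_subtractf inner_sum_right sum_distrib_left)
      finally have cross: "(\<Sum>p\<in>P. (norm (grad (z p \<omega>) - a))\<^sup>2 - (norm a)\<^sup>2)
          = (\<Sum>p\<in>P. (norm (grad (z p \<omega>)))\<^sup>2) - 2 * inner a v" .
      show ?thesis unfolding cross by (simp add: algebra_simps)
    qed
    also have "(\<Sum>p\<in>P. (norm (grad (z p \<omega>) - a))\<^sup>2 - (norm a)\<^sup>2)
        \<le> (\<Sum>p\<in>P. L\<^sup>2 * (norm (z p \<omega> - x \<omega>))\<^sup>2 - (norm a)\<^sup>2)"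
    proof (intro sum_mono diff_right_mono)
      fix p
      show "(norm (grad (z p \<omega>) - a))\<^sup>2 \<le> L\<^sup>2 * (norm (z p \<omega> - x \<omega>))\<^sup>2"
        using power_mono[OF smooth[of "z p \<omega>" "x \<omega>"], of 2] by (simp add: a_def power_mult_distrib)
    qed
    finally show ?thesis
      using \<open>0 \<le> \<eta>\<close> by (simp add: a_def w_def inner_sum_right mult_left_mono)
  qed
  have int_f: "integrable M (\<lambda>\<omega>. f (x \<omega>))" "integrable M (\<lambda>\<omega>. f (x' \<omega>))"
    using x x' by (auto intro: smooth_comp_integrable[OF gradient smooth lower])
  have int_drift: "integrable M (\<lambda>\<omega>. L\<^sup>2 * (norm (z p \<omega> - x \<omega>))\<^sup>2 - (norm (grad (x \<omega>)))\<^sup>2)"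
    and E_drift: "expectation (\<lambda>\<omega>. L\<^sup>2 * (norm (z p \<omega> - x \<omega>))\<^sup>2 - (norm (grad (x \<omega>)))\<^sup>2) \<le> C - G"
    if "p \<in> P" for p
    using sq_integrable_norm[OF sq_integrable_diff[OF z[OF that] x]] sq_integrable_norm[OF grad_x]
      drift[OF that] by (simp_all add: G_def)
  have int_inner: "integrable M (\<lambda>\<omega>. inner (grad (x \<omega>)) (\<zeta> p \<omega>))" if "p \<in> P" for p
    by (rule sq_integrable_inner[OF grad_x \<zeta>[OF that]])
  have int_noise: "integrable M (\<lambda>\<omega>. (norm (\<Sum>p\<in>P. 1 *\<^sub>R \<zeta> p \<omega>))\<^sup>2)"
    by (intro sq_integrable_norm sq_integrable_sum sq_integrable_scaleR \<zeta>)
  have E_noise: "expectation (\<lambda>\<omega>. (norm (\<Sum>p\<in>P. 1 *\<^sub>R \<zeta> p \<omega>))\<^sup>2) \<le> N * s"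
  proof -
    have "expectation (\<lambda>\<omega>. (norm (\<Sum>p\<in>P. 1 *\<^sub>R \<zeta> p \<omega>))\<^sup>2)
        = (\<Sum>p\<in>P. 1\<^sup>2 * expectation (\<lambda>\<omega>. (norm (\<zeta> p \<omega>))\<^sup>2))"
      by (intro second_moment_sum_orthogonal \<open>finite P\<close> \<zeta> orth)
    also have "\<dots> \<le> (\<Sum>p\<in>P. s)" by (intro sum_mono) (simp add: var)
    finally show ?thesis by (simp add: N_def)
  qed
  have "expectation (\<lambda>\<omega>. f (x' \<omega>)) \<le> expectation (\<lambda>\<omega>. f (x \<omega>)
      + \<eta> / 2 * (\<Sum>p\<in>P. L\<^sup>2 * (norm (z p \<omega> - x \<omega>))\<^sup>2 - (norm (grad (x \<omega>)))\<^sup>2)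
      - \<eta> * (\<Sum>p\<in>P. inner (grad (x \<omega>)) (\<zeta> p \<omega>))
      + L * \<eta>\<^sup>2 * (norm (\<Sum>p\<in>P. 1 *\<^sub>R \<zeta> p \<omega>))\<^sup>2)"
    by (intro integral_mono pointwise int_f Bochner_Integration.integrable_add
        Bochner_Integration.integrable_diff integrable_mult_right
        Bochner_Integration.integrable_sum int_drift int_inner int_noise)
  also have "\<dots> = expectation (\<lambda>\<omega>. f (x \<omega>))
      + \<eta> / 2 * (\<Sum>p\<in>P. expectation (\<lambda>\<omega>. L\<^sup>2 * (norm (z p \<omega> - x \<omega>))\<^sup>2 - (norm (grad (x \<omega>)))\<^sup>2))
      - \<eta> * (\<Sum>p\<in>P. expectation (\<lambda>\<omega>. inner (grad (x \<omega>)) (\<zeta> p \<omega>)))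
      + L * \<eta>\<^sup>2 * expectation (\<lambda>\<omega>. (norm (\<Sum>p\<in>P. 1 *\<^sub>R \<zeta> p \<omega>))\<^sup>2)"
  proof -
    have A: "integrable M (\<lambda>\<omega>. \<eta> / 2 * (\<Sum>p\<in>P. L\<^sup>2 * (norm (z p \<omega> - x \<omega>))\<^sup>2 - (norm (grad (x \<omega>)))\<^sup>2))"
      and B: "integrable M (\<lambda>\<omega>. \<eta> * (\<Sum>p\<in>P. inner (grad (x \<omega>)) (\<zeta> p \<omega>)))"
      and D: "integrable M (\<lambda>\<omega>. L * \<eta>\<^sup>2 * (norm (\<Sum>p\<in>P. 1 *\<^sub>R \<zeta> p \<omega>))\<^sup>2)"
      by (intro integrable_mult_right Bochner_Integration.integrable_sum int_drift int_inner int_noise;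
          assumption)+
    have A': "expectation (\<lambda>\<omega>. \<Sum>p\<in>P. L\<^sup>2 * (norm (z p \<omega> - x \<omega>))\<^sup>2 - (norm (grad (x \<omega>)))\<^sup>2)
        = (\<Sum>p\<in>P. expectation (\<lambda>\<omega>. L\<^sup>2 * (norm (z p \<omega> - x \<omega>))\<^sup>2 - (norm (grad (x \<omega>)))\<^sup>2))"
      by (rule Bochner_Integration.integral_sum) (rule int_drift)
    have B': "expectation (\<lambda>\<omega>. \<Sum>p\<in>P. inner (grad (x \<omega>)) (\<zeta> p \<omega>))
        = (\<Sum>p\<in>P. expectation (\<lambda>\<omega>. inner (grad (x \<omega>)) (\<zeta> p \<omega>)))"
      by (rule Bochner_Integration.integral_sum) (rule int_inner)
    note I = int_f(1) A B D
    show ?thesis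
      by (simp only: Bochner_Integration.integral_add Bochner_Integration.integral_diff
          Bochner_Integration.integrable_add Bochner_Integration.integrable_diff I
          Bochner_Integration.integral_mult_right_zero A' B')
  qed
  also have "\<dots> \<le> expectation (\<lambda>\<omega>. f (x \<omega>)) + \<eta> / 2 * (\<Sum>p\<in>P. C - G) - \<eta> * 0 + L * \<eta>\<^sup>2 * (N * s)"
    using \<open>0 \<le> \<eta>\<close> \<open>L > 0\<close> E_noise
    by (intro add_mono diff_mono mult_left_mono sum_mono E_drift order_refl) (simp_all add: centered)
  also have "\<dots> = expectation (\<lambda>\<omega>. f (x \<omega>)) + \<eta> * N * ((C - G) / 2 + L * \<eta> * s)"
    by (simp add: N_def field_simps power2_eq_square)
  finally show ?thesis by (simp add: N_def G_def)
qed

end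

section \<open>Gradients evaluated with fresh samples\<close>

text \<open>The information carried by the samples \<open>Y p\<close> with \<open>p \<in> A\<close>: the coarsest \<open>\<sigma>\<close>-algebra on the
  sample space that makes all of them measurable.\<close>

definition generated_algebra ::
  "'w measure \<Rightarrow> 'x measure \<Rightarrow> ('p \<Rightarrow> 'w \<Rightarrow> 'x) \<Rightarrow> 'p set \<Rightarrow> 'w measure" where
  "generated_algebra M D Y A = vimage_algebra (space M) (\<lambda>\<omega>. \<lambda>p\<in>A. Y p \<omega>) (PiM A (\<lambda>_. D))"

text \<open>Independence of \<open>Y\<close> from the \<open>\<sigma>\<close>-algebra \<open>F\<close>, together with the law \<open>D\<close> of \<open>Y\<close>, expressed through the
  joint law of the outcome and \<open>Y\<close>. In this form the conditional expectation given \<open>F\<close> of a function of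
  an \<open>F\<close>-measurable quantity and \<open>Y\<close> is the inner integral of Fubini's theorem.\<close>

definition fresh_sample :: "'w measure \<Rightarrow> 'w measure \<Rightarrow> 'x measure \<Rightarrow> ('w \<Rightarrow> 'x) \<Rightarrow> bool" where
  "fresh_sample M F D Y \<longleftrightarrow> (\<lambda>\<omega>. \<omega>) \<in> M \<rightarrow>\<^sub>M F \<and> Y \<in> M \<rightarrow>\<^sub>M D \<and>
     distr M (F \<Otimes>\<^sub>M D) (\<lambda>\<omega>. (\<omega>, Y \<omega>)) = distr M F (\<lambda>\<omega>. \<omega>) \<Otimes>\<^sub>M D"

context prob_space
begin

lemma restrict_in_space_PiM:
  assumes "\<And>p. p \<in> A \<Longrightarrow> Y p \<in> M \<rightarrow>\<^sub>M D"
  shows "(\<lambda>\<omega>. \<lambda>p\<in>A. Y p \<omega>) \<in> space M \<rightarrow> space (PiM A (\<lambda>_. D))"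
  using measurable_space[OF assms] by (auto simp: space_PiM)

lemma generated_algebra_component:
  assumes Y: "\<And>p. p \<in> A \<Longrightarrow> Y p \<in> M \<rightarrow>\<^sub>M D" and "p \<in> A"
  shows "Y p \<in> generated_algebra M D Y A \<rightarrow>\<^sub>M D"
proof -
  have "(\<lambda>\<omega>. \<lambda>p\<in>A. Y p \<omega>) \<in> generated_algebra M D Y A \<rightarrow>\<^sub>M PiM A (\<lambda>_. D)"
    unfolding generated_algebra_def
    by (rule measurable_vimage_algebra1[OF restrict_in_space_PiM[OF Y]])
  from measurable_compose[OF this measurable_component_singleton[OF \<open>p \<in> A\<close>]]
  show ?thesis using \<open>p \<in> A\<close> by simp
qed

text \<open>Both laws agree on rectangles, where the claim is the independence of the families indexed by
  \<open>A\<close> and by \<open>{p}\<close>; the second family is a tuple with the single entry \<open>Y p\<close>, hence the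
  translation of events about \<open>Y p\<close> into events about that tuple.\<close>

lemma generated_algebra_fresh:
  assumes indep: "indep_vars (\<lambda>_. D) Y I" and "A \<subseteq> I" "p \<in> I" "p \<notin> A"
    and law: "distr M D (Y p) = D"
  shows "fresh_sample M (generated_algebra M D Y A) D (Y p)"
proof -
  let ?F = "generated_algebra M D Y A" and ?N = "PiM A (\<lambda>_. D)" and ?r = "\<lambda>\<omega>. \<lambda>q\<in>A. Y q \<omega>"
  let ?N' = "PiM {p} (\<lambda>_. D)" and ?r' = "\<lambda>\<omega>. \<lambda>q\<in>{p}. Y q \<omega>"
  have Y: "Y q \<in> M \<rightarrow>\<^sub>M D" if "q \<in> I" for q
    using indep that by (simp add: indep_vars_def2)
  have r: "?r \<in> space M \<rightarrow> space ?N"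
    using Y \<open>A \<subseteq> I\<close> by (intro restrict_in_space_PiM) auto
  have sets_F: "sets ?F = {?r -` B \<inter> space M | B. B \<in> sets ?N}"
    unfolding generated_algebra_def by (rule sets_vimage_algebra2[OF r])
  have space_F: "space ?F = space M" by (simp add: generated_algebra_def)
  have ind: "indep_var ?N ?r ?N' ?r'"
    using assms by (intro indep_var_restrict[OF indep]) auto
  have r_meas: "?r \<in> M \<rightarrow>\<^sub>M ?N" using ind by (simp add: indep_var_eq)
  have Fm: "(\<lambda>\<omega>. \<omega>) \<in> M \<rightarrow>\<^sub>M ?F"
  proof (rule measurableI)
    fix B assume "B \<in> sets ?F"
    then obtain B' where "B = ?r -` B' \<inter> space M" "B' \<in> sets ?N" by (auto simp: sets_F)
    then show "(\<lambda>\<omega>. \<omega>) -` B \<inter> space M \<in> sets M"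
      using measurable_sets[OF r_meas, of B'] by (simp add: Int_assoc)
  qed (simp add: space_F)
  have Yp: "Y p \<in> M \<rightarrow>\<^sub>M D" using Y \<open>p \<in> I\<close> by simp
  have D: "prob_space D" using prob_space_distr[OF Yp] by (simp add: law)
  have "distr M ?F (\<lambda>\<omega>. \<omega>) \<Otimes>\<^sub>M D = distr M (?F \<Otimes>\<^sub>M D) (\<lambda>\<omega>. (\<omega>, Y p \<omega>))"
  proof (rule pair_measure_eqI)
    show "sigma_finite_measure (distr M ?F (\<lambda>\<omega>. \<omega>))"
      by (intro prob_space_imp_sigma_finite prob_space_distr Fm)
    show "sigma_finite_measure D" by (rule prob_space_imp_sigma_finite[OF D])
    show "sets (distr M ?F (\<lambda>\<omega>. \<omega>) \<Otimes>\<^sub>M D) = sets (distr M (?F \<Otimes>\<^sub>M D) (\<lambda>\<omega>. (\<omega>, Y p \<omega>)))"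
      by (simp cong: sets_pair_measure_cong)
    fix B C assume "B \<in> sets (distr M ?F (\<lambda>\<omega>. \<omega>))" and C: "C \<in> sets D"
    then have B: "B \<in> sets ?F" by simp
    have BM: "B \<subseteq> space M" using sets.sets_into_space[OF B] by (simp add: space_F)
    obtain B' where B': "B = ?r -` B' \<inter> space M" "B' \<in> sets ?N" using B by (auto simp: sets_F)
    have C': "Y p -` C \<inter> space M = ?r' -` {y \<in> space ?N'. y p \<in> C} \<inter> space M"
      using measurable_space[OF Yp] by (auto simp: space_PiM)
    have "{y \<in> space ?N'. y p \<in> C} \<in> sets ?N'"
      using measurable_sets[OF measurable_component_singleton[of p "{p}" "\<lambda>_. D"] C]
      by (simp add: vimage_def Int_def conj_commute)
    then have "Y p -` C \<inter> space M \<in> sigma_sets (space M) {?r' -` A \<inter> space M | A. A \<in> sets ?N'}"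
      unfolding C' by (intro sigma_sets.Basic) blast
    moreover have "B \<in> sigma_sets (space M) {?r -` A \<inter> space M | A. A \<in> sets ?N}"
      using B' by (intro sigma_sets.Basic) auto
    ultimately have "prob (B \<inter> (Y p -` C \<inter> space M)) = prob B * prob (Y p -` C \<inter> space M)"
      using ind by (intro indep_setD) (auto simp: indep_var_eq)
    moreover have "(\<lambda>\<omega>. (\<omega>, Y p \<omega>)) -` (B \<times> C) \<inter> space M = B \<inter> (Y p -` C \<inter> space M)"
      by auto
    moreover have "(\<lambda>\<omega>. \<omega>) -` B \<inter> space M = B" using BM by auto
    moreover have "emeasure D C = emeasure M (Y p -` C \<inter> space M)"
      using emeasure_distr[OF Yp C] by (simp add: law)
    ultimately show "emeasure (distr M ?F (\<lambda>\<omega>. \<omega>)) B * emeasure D C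
        = emeasure (distr M (?F \<Otimes>\<^sub>M D) (\<lambda>\<omega>. (\<omega>, Y p \<omega>))) (B \<times> C)"
      using B C Fm Yp by (simp add: emeasure_distr measurable_Pair emeasure_eq_measure ennreal_mult)
  qed
  then show ?thesis using Fm Yp by (simp add: fresh_sample_def)
qed

end

locale stochastic_gradient = prob_space M + D: prob_space D
  for M :: "'w measure" and D :: "'x measure" +
  fixes grad :: "'a::euclidean_space \<Rightarrow> 'a" and g :: "'a \<Rightarrow> 'x \<Rightarrow> 'a" and L s :: real
  assumes L_pos: "L > 0"
    and smooth: "\<And>x y. norm (grad x - grad y) \<le> L * norm (x - y)"
    and s_nonneg: "0 \<le> s"
    and g_measurable: "(\<lambda>(x, y). g x y) \<in> borel_measurable (borel \<Otimes>\<^sub>M D)"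
    and unbiased: "\<And>x. has_bochner_integral D (g x) (grad x)"
    and variance: "\<And>x. (\<integral>\<^sup>+ y. ennreal ((norm (g x y - grad x))\<^sup>2) \<partial>D) \<le> ennreal s"
begin

lemma grad_measurable [measurable]: "grad \<in> borel_measurable borel"
  by (rule lipschitz_borel_measurable[OF L_pos smooth])

lemma g_compose_measurable [measurable (raw)]:
  assumes "z \<in> borel_measurable N" "Y \<in> N \<rightarrow>\<^sub>M D"
  shows "(\<lambda>\<omega>. g (z \<omega>) (Y \<omega>)) \<in> borel_measurable N"
  using measurable_compose[OF measurable_Pair[OF assms] g_measurable] by simp

lemma sq_integrable_grad: "sq_integrable M X \<Longrightarrow> sq_integrable M (\<lambda>\<omega>. grad (X \<omega>))"
  by (rule sq_integrable_lipschitz[OF _ L_pos smooth])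

lemma fresh_noise:
  assumes fresh: "fresh_sample M F D Y"
    and z[measurable]: "z \<in> borel_measurable F"
  shows "sq_integrable M (\<lambda>\<omega>. g (z \<omega>) (Y \<omega>) - grad (z \<omega>))"
    and "expectation (\<lambda>\<omega>. (norm (g (z \<omega>) (Y \<omega>) - grad (z \<omega>)))\<^sup>2) \<le> s"
proof -
  have F[measurable]: "(\<lambda>\<omega>. \<omega>) \<in> M \<rightarrow>\<^sub>M F" "Y \<in> M \<rightarrow>\<^sub>M D"
    and joint: "distr M (F \<Otimes>\<^sub>M D) (\<lambda>\<omega>. (\<omega>, Y \<omega>)) = distr M F (\<lambda>\<omega>. \<omega>) \<Otimes>\<^sub>M D"
    using fresh by (simp_all add: fresh_sample_def)
  let ?P = "distr M F (\<lambda>\<omega>. \<omega>)"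
  let ?h = "\<lambda>(w, y). ennreal ((norm (g (z w) y - grad (z w)))\<^sup>2)"
  have [measurable]: "z \<in> borel_measurable M"
    using measurable_compose[OF F(1) z] .
  have h[measurable]: "?h \<in> borel_measurable (F \<Otimes>\<^sub>M D)" by measurable
  have h': "?h \<in> borel_measurable (?P \<Otimes>\<^sub>M D)" by measurable
  interpret P: prob_space ?P by (rule prob_space_distr) measurable
  have "(\<integral>\<^sup>+\<omega>. ennreal ((norm (g (z \<omega>) (Y \<omega>) - grad (z \<omega>)))\<^sup>2) \<partial>M)
      = (\<integral>\<^sup>+q. ?h q \<partial>distr M (F \<Otimes>\<^sub>M D) (\<lambda>\<omega>. (\<omega>, Y \<omega>)))"
    by (subst nn_integral_distr) simp_all
  also have "\<dots> = (\<integral>\<^sup>+w. \<integral>\<^sup>+y. ?h (w, y) \<partial>D \<partial>?P)"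
    unfolding joint by (rule D.nn_integral_fst[OF h', symmetric])
  also have "\<dots> \<le> (\<integral>\<^sup>+w. ennreal s \<partial>?P)"
    by (intro nn_integral_mono) (simp add: variance)
  also have "\<dots> = ennreal s" by (simp add: P.emeasure_space_1[simplified])
  finally have le: "(\<integral>\<^sup>+\<omega>. ennreal ((norm (g (z \<omega>) (Y \<omega>) - grad (z \<omega>)))\<^sup>2) \<partial>M) \<le> ennreal s" .
  have int: "integrable M (\<lambda>\<omega>. (norm (g (z \<omega>) (Y \<omega>) - grad (z \<omega>)))\<^sup>2)"
    using le by (intro integrableI_nonneg) (auto simp: le_less_trans[OF _ ennreal_less_top])
  then show "sq_integrable M (\<lambda>\<omega>. g (z \<omega>) (Y \<omega>) - grad (z \<omega>))" by (simp add: sq_integrable_def)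
  have "ennreal (expectation (\<lambda>\<omega>. (norm (g (z \<omega>) (Y \<omega>) - grad (z \<omega>)))\<^sup>2)) \<le> ennreal s"
    using le by (subst nn_integral_eq_integral[OF int, symmetric]) simp_all
  then show "expectation (\<lambda>\<omega>. (norm (g (z \<omega>) (Y \<omega>) - grad (z \<omega>)))\<^sup>2) \<le> s"
    using s_nonneg by simp
qed

text \<open>Given the past \<open>F\<close>, the point \<open>z\<close> and the vector \<open>u\<close> are constants, and unbiasedness makes the
  integral over the fresh sample vanish. This serves both for the cross terms with the gradient at the start of a round
  and for those between two noises.\<close>

lemma fresh_noise_uncorrelated:
  assumes fresh: "fresh_sample M F D Y"
    and z[measurable]: "z \<in> borel_measurable F"
    and u[measurable]: "u \<in> borel_measurable F" and u_sq: "sq_integrable M u"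
  shows "expectation (\<lambda>\<omega>. inner (u \<omega>) (g (z \<omega>) (Y \<omega>) - grad (z \<omega>))) = 0"
proof -
  have F[measurable]: "(\<lambda>\<omega>. \<omega>) \<in> M \<rightarrow>\<^sub>M F" "Y \<in> M \<rightarrow>\<^sub>M D"
    and joint: "distr M (F \<Otimes>\<^sub>M D) (\<lambda>\<omega>. (\<omega>, Y \<omega>)) = distr M F (\<lambda>\<omega>. \<omega>) \<Otimes>\<^sub>M D"
    using fresh by (simp_all add: fresh_sample_def)
  let ?P = "distr M F (\<lambda>\<omega>. \<omega>)"
  let ?h = "\<lambda>(w, y). inner (u w) (g (z w) y - grad (z w))"
  interpret P: prob_space ?P by (rule prob_space_distr) measurable
  interpret PD: pair_sigma_finite ?P D ..
  have h[measurable]: "?h \<in> borel_measurable (F \<Otimes>\<^sub>M D)" by measurable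
  have "integrable M (\<lambda>\<omega>. ?h (\<omega>, Y \<omega>))"
    using sq_integrable_inner[OF u_sq fresh_noise(1)[OF fresh z]] by simp
  then have "integrable (distr M (F \<Otimes>\<^sub>M D) (\<lambda>\<omega>. (\<omega>, Y \<omega>))) ?h"
    by (subst integrable_distr_eq) simp_all
  then have int: "integrable (?P \<Otimes>\<^sub>M D) ?h" by (simp only: joint)
  have "expectation (\<lambda>\<omega>. inner (u \<omega>) (g (z \<omega>) (Y \<omega>) - grad (z \<omega>)))
      = (\<integral>q. ?h q \<partial>distr M (F \<Otimes>\<^sub>M D) (\<lambda>\<omega>. (\<omega>, Y \<omega>)))"
    by (subst integral_distr) simp_all
  also have "\<dots> = (\<integral>w. \<integral>y. ?h (w, y) \<partial>D \<partial>?P)"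
    unfolding joint by (rule PD.integral_fst'[OF int, symmetric])
  also have "(\<lambda>w. \<integral>y. ?h (w, y) \<partial>D) = (\<lambda>w. 0)"
  proof
    fix w
    have g: "integrable D (g (z w))" "(\<integral>y. g (z w) y \<partial>D) = grad (z w)"
      using unbiased[of "z w"] by (auto simp: has_bochner_integral_iff)
    show "(\<integral>y. ?h (w, y) \<partial>D) = 0"
      using g by (simp add: integral_inner_right D.prob_space)
  qed
  finally show ?thesis by simp
qed

end

section \<open>Decaying Local SGD as a random process\<close>

locale local_sgd = stochastic_gradient M D grad g L s
  for M :: "'w measure" and D :: "'x measure"
    and grad :: "'a::euclidean_space \<Rightarrow> 'a" and g :: "'a \<Rightarrow> 'x \<Rightarrow> 'a" and L s :: real +
  fixes \<xi> :: "nat \<Rightarrow> nat \<Rightarrow> nat \<Rightarrow> 'w \<Rightarrow> 'x" and n K R :: nat and \<eta>\<^sub>g b :: real and x0 :: 'a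
  assumes indep: "indep_vars (\<lambda>_. D) (\<lambda>(t, i, j). \<xi> t i j) ({..<R} \<times> {1..n} \<times> {..<K})"
    and law: "\<And>t i j. t < R \<Longrightarrow> i \<in> {1..n} \<Longrightarrow> j < K \<Longrightarrow> distr M D (\<xi> t i j) = D"
begin

definition samples :: "(nat \<times> nat \<times> nat) set" where
  "samples = {..<R} \<times> {1..n} \<times> {..<K}"

definition info :: "(nat \<times> nat \<times> nat) set \<Rightarrow> 'w measure" where
  "info A = generated_algebra M D (\<lambda>(t, i, j). \<xi> t i j) A"

text \<open>The samples of one round are drawn in parallel, but for proving that all noises of a round are pairwise
  uncorrelated a linear order is convenient: of any two noises, the one that comes first is then
  determined by the samples that precede the other. The lexicographic order on (round, worker, local
  step) has this property, because a local point depends only on samples of earlier rounds and on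
  earlier samples of the same worker.\<close>

definition past :: "nat \<Rightarrow> nat \<Rightarrow> nat \<Rightarrow> (nat \<times> nat \<times> nat) set" where
  "past t i j = {(t', i', j') \<in> samples. t' < t \<or> t' = t \<and> (i' < i \<or> i' = i \<and> j' < j)}"

abbreviation \<eta> :: "nat \<Rightarrow> real" where
  "\<eta> \<equiv> local_step_size \<eta>\<^sub>g b K"

abbreviation iter :: "nat \<Rightarrow> 'w \<Rightarrow> 'a" where
  "iter t \<omega> \<equiv> decaying_local_sgd n K \<eta>\<^sub>g b g x0 (\<lambda>t i j. \<xi> t i j \<omega>) t"

abbreviation loc :: "nat \<Rightarrow> nat \<Rightarrow> nat \<Rightarrow> 'w \<Rightarrow> 'a" where
  "loc t i j \<omega> \<equiv> local_iterate \<eta> g (\<lambda>j. \<xi> t i j \<omega>) (iter t \<omega>) j"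

definition noise :: "nat \<Rightarrow> nat \<Rightarrow> nat \<Rightarrow> 'w \<Rightarrow> 'a" where
  "noise t i j \<omega> = g (loc t i j \<omega>) (\<xi> t i j \<omega>) - grad (loc t i j \<omega>)"

lemma loc_measurable_of:
  assumes "iter t \<in> borel_measurable N" and "\<And>l. l < j \<Longrightarrow> \<xi> t i l \<in> N \<rightarrow>\<^sub>M D"
  shows "loc t i j \<in> borel_measurable N"
  using assms(2)
proof (induction j)
  case 0
  then show ?case using assms(1) by simp
next
  case (Suc j)
  then have [measurable]: "loc t i j \<in> borel_measurable N" "\<xi> t i j \<in> N \<rightarrow>\<^sub>M D" by simp_all
  show ?case by simp
qed

lemma iter_measurable_of:
  assumes "\<And>t' i j. t' < t \<Longrightarrow> i \<in> {1..n} \<Longrightarrow> j < K \<Longrightarrow> \<xi> t' i j \<in> N \<rightarrow>\<^sub>M D"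
  shows "iter t \<in> borel_measurable N"
  using assms
proof (induction t)
  case (Suc t)
  then have [measurable]: "iter t \<in> borel_measurable N" by simp
  have [measurable]: "(\<lambda>\<omega>. g (loc t i j \<omega>) (\<xi> t i j \<omega>)) \<in> borel_measurable N"
    if "i \<in> {1..n}" "j \<in> {..<K}" for i j
    using that Suc.prems by (intro g_compose_measurable loc_measurable_of) auto
  show ?case by (simp add: Let_def)
qed simp

lemma sample_measurable:
  assumes "(t, i, j) \<in> samples"
  shows "\<xi> t i j \<in> M \<rightarrow>\<^sub>M D"
  using indep assms unfolding samples_def indep_vars_def2 by force

lemma info_component:
  assumes "A \<subseteq> samples" "(t, i, j) \<in> A"
  shows "\<xi> t i j \<in> info A \<rightarrow>\<^sub>M D"
  using generated_algebra_component[of A "\<lambda>(t, i, j). \<xi> t i j" D "(t, i, j)"] assms sample_measurable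
  unfolding info_def by force

lemma past_subset: "past t i j \<subseteq> samples"
  by (auto simp: past_def)

lemma fresh:
  assumes "(t, i, j) \<in> samples"
  shows "fresh_sample M (info (past t i j)) D (\<xi> t i j)"
proof -
  have "fresh_sample M (generated_algebra M D (\<lambda>(t, i, j). \<xi> t i j) (past t i j)) D
      ((\<lambda>(t, i, j). \<xi> t i j) (t, i, j))"
    using assms law by (intro generated_algebra_fresh[OF indep]) (auto simp: past_def samples_def)
  then show ?thesis by (simp add: info_def)
qed

lemma iter_past: "t \<le> R \<Longrightarrow> iter t \<in> borel_measurable (info (past t i j))"
  by (intro iter_measurable_of info_component past_subset) (auto simp: past_def samples_def)

lemma loc_past:
  assumes "(t, i, j) \<in> samples"
  shows "loc t i j \<in> borel_measurable (info (past t i j))"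
  using assms
  by (intro loc_measurable_of iter_past info_component past_subset) (auto simp: past_def samples_def)

lemma noise_past:
  assumes p: "(t, i, j) \<in> samples" and q: "(t, i', j') \<in> samples"
    and less: "i < i' \<or> i = i' \<and> j < j'"
  shows "noise t i j \<in> borel_measurable (info (past t i' j'))"
proof -
  let ?F = "info (past t i' j')"
  have "\<xi> t i l \<in> ?F \<rightarrow>\<^sub>M D" if "l \<le> j" for l
    using that p less by (intro info_component past_subset) (auto simp: past_def samples_def)
  moreover have "iter t \<in> borel_measurable ?F" using p by (intro iter_past) (simp add: samples_def)
  ultimately have [measurable]: "loc t i j \<in> borel_measurable ?F" "\<xi> t i j \<in> ?F \<rightarrow>\<^sub>M D"
    by (auto intro: loc_measurable_of)
  show ?thesis unfolding noise_def by measurable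
qed

lemma noise_second_moment:
  assumes "(t, i, j) \<in> samples"
  shows "sq_integrable M (noise t i j)" "expectation (\<lambda>\<omega>. (norm (noise t i j \<omega>))\<^sup>2) \<le> s"
  using fresh_noise[OF fresh[OF assms] loc_past[OF assms]] by (simp_all add: noise_def[abs_def])

lemma noise_centered:
  assumes "(t, i, j) \<in> samples" "u \<in> borel_measurable (info (past t i j))" "sq_integrable M u"
  shows "expectation (\<lambda>\<omega>. inner (u \<omega>) (noise t i j \<omega>)) = 0"
  using fresh_noise_uncorrelated[OF fresh[OF assms(1)] loc_past[OF assms(1)] assms(2,3)]
  by (simp add: noise_def)

lemma noise_uncorrelated:
  assumes p: "(t, i, j) \<in> samples" and q: "(t, i', j') \<in> samples" and "(i, j) \<noteq> (i', j')"
  shows "expectation (\<lambda>\<omega>. inner (noise t i j \<omega>) (noise t i' j' \<omega>)) = 0"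
proof -
  consider "i < i' \<or> i = i' \<and> j < j'" | "i' < i \<or> i' = i \<and> j' < j"
    using assms(3) by fastforce
  then show ?thesis
  proof cases
    case 1
    then show ?thesis
      by (intro noise_centered noise_second_moment noise_past p q)
  next
    case 2
    have "expectation (\<lambda>\<omega>. inner (noise t i' j' \<omega>) (noise t i j \<omega>)) = 0"
      by (intro noise_centered noise_second_moment noise_past p q 2)
    then show ?thesis by (simp add: inner_commute)
  qed
qed

lemma loc_step: "loc t i (Suc j) \<omega> = loc t i j \<omega> - \<eta> j *\<^sub>R (grad (loc t i j \<omega>) + noise t i j \<omega>)"
  by (simp add: noise_def)

lemma iter_step:
  "iter (Suc t) \<omega> = iter t \<omega> - \<eta>\<^sub>g *\<^sub>R
     (\<Sum>(i, j)\<in>{1..n} \<times> {..<K}. grad (loc t i j \<omega>) + noise t i j \<omega>)"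
  by (simp add: noise_def Let_def sum.cartesian_product)

lemma loc_sq_integrable:
  assumes "sq_integrable M (iter t)" "t < R" "i \<in> {1..n}" "j \<le> K"
  shows "sq_integrable M (loc t i j)"
  using \<open>j \<le> K\<close>
proof (induction j)
  case 0
  then show ?case using assms by simp
next
  case (Suc j)
  then have "sq_integrable M (loc t i j)" "(t, i, j) \<in> samples"
    using assms by (simp_all add: samples_def)
  then show ?case unfolding loc_step
    by (intro sq_integrable_diff sq_integrable_scaleR sq_integrable_add sq_integrable_grad
        noise_second_moment)
qed

lemma iter_sq_integrable: "t \<le> R \<Longrightarrow> sq_integrable M (iter t)"
proof (induction t)
  case 0
  then show ?case by (simp add: sq_integrable_const)
next
  case (Suc t)
  then have "sq_integrable M (iter t)" by simp
  then show ?case unfolding iter_step split_beta using Suc.prems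
    by (intro sq_integrable_diff sq_integrable_scaleR sq_integrable_add sq_integrable_grad
        noise_second_moment sq_integrable_sum loc_sq_integrable) (auto simp: samples_def)
qed

text \<open>The last gradient of a round is taken at local point \<open>K - 1\<close>, which is reached with the first
  \<open>K - 1\<close> steps; hence the upper limit of the sums. For \<open>K = 1\<close> they are empty and there is no drift at all.\<close>

lemma loc_drift:
  assumes "t < R" "i \<in> {1..n}" "j < K"
    and "0 \<le> \<eta>\<^sub>g" "0 \<le> b" "K \<ge> 1"
    and "L\<^sup>2 * (\<Sum>l<K - 1. \<eta> l)\<^sup>2 \<le> 1 / 24"
    and "L\<^sup>2 * s * (\<Sum>l<K - 1. (\<eta> l)\<^sup>2) \<le> \<beta>"
  shows "L\<^sup>2 * expectation (\<lambda>\<omega>. (norm (loc t i j \<omega> - iter t \<omega>))\<^sup>2)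
    \<le> 12 / 5 * \<beta> + 1 / 5 * expectation (\<lambda>\<omega>. (norm (grad (iter t \<omega>)))\<^sup>2)"
proof -
  have "L\<^sup>2 * expectation (\<lambda>\<omega>. (norm (loc t i j \<omega> - loc t i 0 \<omega>))\<^sup>2)
    \<le> 12 / 5 * \<beta> + 1 / 5 * expectation (\<lambda>\<omega>. (norm (grad (loc t i 0 \<omega>)))\<^sup>2)"
  proof (rule local_drift[where m = "K - 1" and z = "loc t i" and \<zeta> = "noise t i" and \<eta> = \<eta> and s = s])
    show "0 \<le> \<eta> l" for l
      using assms by (simp add: local_step_size_def)
    show "sq_integrable M (loc t i l)" if "l \<le> K - 1" for l
      using that assms by (intro loc_sq_integrable iter_sq_integrable) auto
    show "expectation (\<lambda>\<omega>. inner (noise t i l \<omega>) (noise t i l' \<omega>)) = 0"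
      if "l < K - 1" "l' < K - 1" "l \<noteq> l'" for l l'
      using that assms by (intro noise_uncorrelated) (auto simp: samples_def)
  qed (use assms L_pos smooth s_nonneg loc_step in
        \<open>auto simp: samples_def intro: noise_second_moment\<close>)
  then show ?thesis by simp
qed

text \<open>The drift uses up a fifth of the gradient term, which leaves \<open>(1 - 1 / 5) / 2 = 2 / 5\<close> of it.\<close>

lemma expected_decrease:
  fixes f :: "'a \<Rightarrow> real"
  assumes gradient: "\<And>x. GDERIV f x :> grad x" and lower: "\<And>x. c \<le> f x"
    and "t < R" "0 \<le> \<eta>\<^sub>g" "0 \<le> b" "K \<ge> 1"
    and small: "L * \<eta>\<^sub>g * real (n * K) \<le> 1 / 2"
    and sums: "L\<^sup>2 * (\<Sum>l<K - 1. \<eta> l)\<^sup>2 \<le> 1 / 24" "L\<^sup>2 * s * (\<Sum>l<K - 1. (\<eta> l)\<^sup>2) \<le> \<beta>"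
  shows "expectation (\<lambda>\<omega>. f (iter (Suc t) \<omega>)) \<le> expectation (\<lambda>\<omega>. f (iter t \<omega>))
    + \<eta>\<^sub>g * real (n * K)
      * (6 / 5 * \<beta> + L * \<eta>\<^sub>g * s - 2 / 5 * expectation (\<lambda>\<omega>. (norm (grad (iter t \<omega>)))\<^sup>2))"
proof -
  define G where "G = expectation (\<lambda>\<omega>. (norm (grad (iter t \<omega>)))\<^sup>2)"
  let ?P = "{1..n} \<times> {..<K}"
  have inP: "(t, fst p, snd p) \<in> samples" if "p \<in> ?P" for p
    using that \<open>t < R\<close> by (auto simp: samples_def)
  have tR: "t \<le> R" using \<open>t < R\<close> by simp
  have "expectation (\<lambda>\<omega>. f (iter (Suc t) \<omega>)) \<le> expectation (\<lambda>\<omega>. f (iter t \<omega>))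
    + \<eta>\<^sub>g * real (card ?P) * (((12 / 5 * \<beta> + 1 / 5 * G) - G) / 2 + L * \<eta>\<^sub>g * s)"
    unfolding G_def
  proof (rule round_progress[where z = "\<lambda>p. loc t (fst p) (snd p)" and \<zeta> = "\<lambda>p. noise t (fst p) (snd p)"])
    show "iter (Suc t) \<omega> = iter t \<omega> - \<eta>\<^sub>g *\<^sub>R (\<Sum>p\<in>?P. grad (loc t (fst p) (snd p) \<omega>) + noise t (fst p) (snd p) \<omega>)"
      for \<omega> unfolding iter_step by (simp add: split_beta)
    fix p assume p: "p \<in> ?P"
    show "sq_integrable M (loc t (fst p) (snd p))"
      using p \<open>t < R\<close> by (intro loc_sq_integrable iter_sq_integrable) auto
    show "sq_integrable M (noise t (fst p) (snd p))"
      "expectation (\<lambda>\<omega>. (norm (noise t (fst p) (snd p) \<omega>))\<^sup>2) \<le> s"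
      by (rule noise_second_moment[OF inP[OF p]])+
    have [measurable]: "iter t \<in> borel_measurable (info (past t (fst p) (snd p)))"
      using tR by (rule iter_past)
    show "expectation (\<lambda>\<omega>. inner (grad (iter t \<omega>)) (noise t (fst p) (snd p) \<omega>)) = 0"
      by (intro noise_centered inP[OF p] sq_integrable_grad iter_sq_integrable tR) measurable
    show "L\<^sup>2 * expectation (\<lambda>\<omega>. (norm (loc t (fst p) (snd p) \<omega> - iter t \<omega>))\<^sup>2)
        \<le> 12 / 5 * \<beta> + 1 / 5 * expectation (\<lambda>\<omega>. (norm (grad (iter t \<omega>)))\<^sup>2)"
      using p assms by (intro loc_drift) auto
    fix q assume q: "q \<in> ?P" "p \<noteq> q"
    then show "expectation (\<lambda>\<omega>. inner (noise t (fst p) (snd p) \<omega>) (noise t (fst q) (snd q) \<omega>)) = 0"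
      by (intro noise_uncorrelated inP p) (auto simp: prod_eq_iff)
  qed (use assms L_pos smooth in \<open>auto intro: iter_sq_integrable\<close>)
  also have "((12 / 5 * \<beta> + 1 / 5 * G) - G) / 2 + L * \<eta>\<^sub>g * s = 6 / 5 * \<beta> + L * \<eta>\<^sub>g * s - 2 / 5 * G"
    by (simp add: field_simps)
  finally show ?thesis by (simp add: G_def)
qed

text \<open>Summing the expected decrease over all rounds telescopes, and the final value of \<open>f\<close> is at least
  \<open>c\<close>.\<close>

lemma sum_gradient_bound:
  fixes f :: "'a \<Rightarrow> real"
  assumes gradient: "\<And>x. GDERIV f x :> grad x" and lower: "\<And>x. c \<le> f x"
    and "0 \<le> \<eta>\<^sub>g" "0 \<le> b" "K \<ge> 1"
    and small: "L * \<eta>\<^sub>g * real (n * K) \<le> 1 / 2"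
    and sums: "L\<^sup>2 * (\<Sum>l<K - 1. \<eta> l)\<^sup>2 \<le> 1 / 24" "L\<^sup>2 * s * (\<Sum>l<K - 1. (\<eta> l)\<^sup>2) \<le> \<beta>"
  shows "\<eta>\<^sub>g * real (n * K) * (2 / 5 * (\<Sum>t<R. expectation (\<lambda>\<omega>. (norm (grad (iter t \<omega>)))\<^sup>2)))
    \<le> f x0 - c + real R * (\<eta>\<^sub>g * real (n * K) * (6 / 5 * \<beta> + L * \<eta>\<^sub>g * s))"
proof -
  define G where "G t = expectation (\<lambda>\<omega>. (norm (grad (iter t \<omega>)))\<^sup>2)" for t
  define \<gamma> where "\<gamma> = \<eta>\<^sub>g * real (n * K)"
  define e where "e = 6 / 5 * \<beta> + L * \<eta>\<^sub>g * s"
  have "expectation (\<lambda>\<omega>. f (iter t \<omega>)) \<le> f x0 + real t * (\<gamma> * e) - \<gamma> * (2 / 5 * (\<Sum>t<t. G t))"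
    if "t \<le> R" for t
    using that
  proof (induction t)
    case 0
    then show ?case by (simp add: prob_space)
  next
    case (Suc t)
    have "expectation (\<lambda>\<omega>. f (iter (Suc t) \<omega>)) \<le> expectation (\<lambda>\<omega>. f (iter t \<omega>)) + \<gamma> * (e - 2 / 5 * G t)"
      unfolding \<gamma>_def e_def G_def using Suc.prems assms by (intro expected_decrease) auto
    also have "\<dots> \<le> f x0 + real t * (\<gamma> * e) - \<gamma> * (2 / 5 * (\<Sum>t<t. G t)) + \<gamma> * (e - 2 / 5 * G t)"
      using Suc.IH Suc.prems by (intro add_right_mono) simp
    also have "\<dots> = f x0 + real (Suc t) * (\<gamma> * e) - \<gamma> * (2 / 5 * (\<Sum>t<Suc t. G t))"
      by (simp add: field_simps)
    finally show ?case .
  qed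
  from this[of R] have "expectation (\<lambda>\<omega>. f (iter R \<omega>)) \<le> f x0 + real R * (\<gamma> * e) - \<gamma> * (2 / 5 * (\<Sum>t<R. G t))"
    by simp
  moreover have "c \<le> expectation (\<lambda>\<omega>. f (iter R \<omega>))"
    by (intro integral_ge_const smooth_comp_integrable[OF gradient smooth lower] iter_sq_integrable)
       (simp_all add: lower)
  ultimately show ?thesis by (simp add: G_def \<gamma>_def e_def)
qed

end

section \<open>Step sizes\<close>

text \<open>Comparison with the integral of \<open>1 / sqrt\<close>, in telescoped form.\<close>

lemma sum_inverse_sqrt_le: "(\<Sum>l<m. 1 / sqrt (real l + 1)) \<le> 2 * sqrt (real m)"
proof (induction m)
  case (Suc m)
  have "1 / sqrt (real m + 1) \<le> 2 * (sqrt (real m + 1) - sqrt (real m))"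
  proof -
    have "1 = (sqrt (real m + 1) - sqrt (real m)) * (sqrt (real m + 1) + sqrt (real m))"
      by (simp add: algebra_simps)
    also have "\<dots> \<le> (sqrt (real m + 1) - sqrt (real m)) * (2 * sqrt (real m + 1))"
      by (intro mult_left_mono) simp_all
    finally show ?thesis by (simp add: field_simps)
  qed
  then show ?case using Suc by (simp add: algebra_simps)
qed simp

lemma sum_inverse_le:
  assumes "K \<ge> 1" "m \<le> K"
  shows "(\<Sum>l<m. 1 / (real l + 1)) \<le> ln (real K) + 1"
proof -
  have "(\<Sum>l<m. 1 / (real l + 1)) \<le> (\<Sum>l<K. 1 / (real l + 1))"
    using \<open>m \<le> K\<close> by (intro sum_mono2) auto
  also have "\<dots> \<le> ln (real K) + 1"
    using \<open>K \<ge> 1\<close>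
  proof (induction K rule: dec_induct)
    case (step k)
    have "ln (real k) - ln (real k + 1) = ln (real k / (real k + 1))"
      using step by (simp add: ln_div)
    also have "\<dots> \<le> real k / (real k + 1) - 1"
      using step by (intro ln_le_minus_one) simp
    also have "\<dots> = - (1 / (real k + 1))" by (simp add: field_simps)
    finally show ?case using step.IH by (simp add: add.commute)
  qed simp
  finally show ?thesis .
qed

text \<open>The square of the sum controls the drift along the gradients, the sum of squares controls the drift
  by noise. The decay like \<open>1 / sqrt (j + 1)\<close> makes the second sum harmonic, and the logarithm in the
  definition of the step sizes is there to cancel it.\<close>

lemma step_sums:
  assumes "K \<ge> 1" "0 \<le> b" "0 \<le> \<eta>"
  shows "(\<Sum>l<K - 1. local_step_size \<eta> b K l)\<^sup>2 \<le> 4 * b * real (K - 1) / (ln (real K) + 1) * \<eta>\<^sup>2"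
    and "(\<Sum>l<K - 1. (local_step_size \<eta> b K l)\<^sup>2) \<le> b * \<eta>\<^sup>2"
proof -
  define \<Lambda> where "\<Lambda> = ln (real K) + 1"
  have \<Lambda>: "\<Lambda> \<ge> 1" using \<open>K \<ge> 1\<close> by (simp add: \<Lambda>_def)
  have split: "local_step_size \<eta> b K l = sqrt (b / \<Lambda>) * \<eta> * (1 / sqrt (real l + 1))" for l
    by (simp add: local_step_size_def \<Lambda>_def real_sqrt_divide real_sqrt_mult)
  have "(\<Sum>l<K - 1. local_step_size \<eta> b K l) = sqrt (b / \<Lambda>) * \<eta> * (\<Sum>l<K - 1. 1 / sqrt (real l + 1))"
    unfolding split by (simp only: sum_distrib_left)
  also have "\<dots> \<le> sqrt (b / \<Lambda>) * \<eta> * (2 * sqrt (real (K - 1)))"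
    using assms \<Lambda> by (intro mult_left_mono sum_inverse_sqrt_le) simp
  finally have "(\<Sum>l<K - 1. local_step_size \<eta> b K l)\<^sup>2 \<le> (sqrt (b / \<Lambda>) * \<eta> * (2 * sqrt (real (K - 1))))\<^sup>2"
    using assms \<Lambda> by (intro power_mono) (auto simp: split intro!: sum_nonneg)
  also have "\<dots> = 4 * b * real (K - 1) / \<Lambda> * \<eta>\<^sup>2"
    using assms \<Lambda> by (simp add: power_mult_distrib)
  finally show "(\<Sum>l<K - 1. local_step_size \<eta> b K l)\<^sup>2 \<le> 4 * b * real (K - 1) / (ln (real K) + 1) * \<eta>\<^sup>2"
    by (simp add: \<Lambda>_def)
  have "(\<Sum>l<K - 1. (local_step_size \<eta> b K l)\<^sup>2) = b / \<Lambda> * \<eta>\<^sup>2 * (\<Sum>l<K - 1. 1 / (real l + 1))"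
    unfolding split using assms \<Lambda> by (simp add: power_mult_distrib power_divide sum_distrib_left)
  also have "\<dots> \<le> b / \<Lambda> * \<eta>\<^sup>2 * \<Lambda>"
    unfolding \<Lambda>_def[symmetric] using assms \<Lambda> sum_inverse_le[OF \<open>K \<ge> 1\<close>, of "K - 1"]
    by (intro mult_left_mono) (simp_all add: \<Lambda>_def)
  also have "\<dots> = b * \<eta>\<^sup>2" using \<Lambda> by simp
  finally show "(\<Sum>l<K - 1. (local_step_size \<eta> b K l)\<^sup>2) \<le> b * \<eta>\<^sup>2" .
qed

text \<open>Put \<open>q = \<sigma>\<^sup>2 / \<epsilon>\<close>, so that \<open>b = max q n\<close> and \<open>L * \<eta>\<^sub>g = min (1 / (8 * q)) (1 / (4 * n))\<close>, with the first
  entry absent if \<open>q = 0\<close>. The total number \<open>n * K\<close> of gradients per round lies between \<open>b\<close> and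
  \<open>q + n\<close>, which keeps the effective step \<open>\<eta>\<^sub>g * n * K\<close> within constant multiples of \<open>1 / L\<close>. If
  \<open>K = 1\<close>, there is no drift and both sums are empty. Otherwise \<open>q > n\<close>, hence \<open>b = q\<close> and
  \<open>K - 1 \<le> q\<close>; moreover \<open>ln K \<ge> 1 / 2\<close>, and this gain over \<open>ln K \<ge> 0\<close> is what brings the first sum
  down to the threshold \<open>1 / 24\<close>.\<close>

lemma parameter_bounds:
  fixes L \<epsilon> \<sigma> \<eta>\<^sub>g b :: real and n K :: nat
  assumes "L > 0" "\<epsilon> > 0" "n \<ge> 1"
    and eta_g: "\<eta>\<^sub>g = (if \<sigma>\<^sup>2 = 0 then 1 / (4 * real n * L)
                    else min (\<epsilon> / (8 * L * \<sigma>\<^sup>2)) (1 / (4 * real n * L)))"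
    and b: "b = max (\<sigma>\<^sup>2 / \<epsilon>) (real n)"
    and K: "K = max (nat \<lceil>\<sigma>\<^sup>2 / (\<epsilon> * real n)\<rceil>) 1"
  shows "0 < \<eta>\<^sub>g" "0 < b" "K \<ge> 1" "real K \<le> 1 + \<sigma>\<^sup>2 / (\<epsilon> * real n)"
    and "L * \<eta>\<^sub>g * \<sigma>\<^sup>2 \<le> \<epsilon> / 8"
    and "L * \<eta>\<^sub>g * real (n * K) \<le> 1 / 2" "1 / 8 \<le> L * \<eta>\<^sub>g * real (n * K)"
    and "L\<^sup>2 * (\<Sum>l<K - 1. local_step_size \<eta>\<^sub>g b K l)\<^sup>2 \<le> 1 / 24"
    and "L\<^sup>2 * \<sigma>\<^sup>2 * (\<Sum>l<K - 1. (local_step_size \<eta>\<^sub>g b K l)\<^sup>2) \<le> \<epsilon> / 64"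
proof -
  define q where "q = \<sigma>\<^sup>2 / \<epsilon>"
  have q0: "0 \<le> q" using \<open>\<epsilon> > 0\<close> by (simp add: q_def)
  have n: "0 < real n" using \<open>n \<ge> 1\<close> by simp
  have \<sigma>: "\<sigma>\<^sup>2 = \<epsilon> * q" using \<open>\<epsilon> > 0\<close> by (simp add: q_def)
  have qn: "\<sigma>\<^sup>2 / (\<epsilon> * real n) = q / real n" by (simp add: q_def)
  show K1: "K \<ge> 1" by (simp add: K)
  show eta0: "0 < \<eta>\<^sub>g" using assms by (auto simp: eta_g)
  show b0: "0 < b" using n by (simp add: b less_max_iff_disj)
  show K_le: "real K \<le> 1 + \<sigma>\<^sup>2 / (\<epsilon> * real n)"
    unfolding K qn using q0 n by (simp add: max_def) linarith
  have L\<eta>: "L * \<eta>\<^sub>g = (if q = 0 then 1 / (4 * real n) else min (1 / (8 * q)) (1 / (4 * real n)))"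
  proof -
    have "L * min (\<epsilon> / (8 * L * \<sigma>\<^sup>2)) (1 / (4 * real n * L)) = min (1 / (8 * q)) (1 / (4 * real n))"
      if "q \<noteq> 0"
      using that \<open>L > 0\<close> \<open>\<epsilon> > 0\<close> by (simp add: min_mult_distrib_left \<sigma>)
    then show ?thesis using \<open>L > 0\<close> \<open>\<epsilon> > 0\<close> by (auto simp: eta_g \<sigma>)
  qed
  have L\<eta>q: "L * \<eta>\<^sub>g * q \<le> 1 / 8"
  proof (cases "q = 0")
    case False
    then have "L * \<eta>\<^sub>g \<le> 1 / (8 * q)" by (simp add: L\<eta>)
    then show ?thesis using q0 False by (simp add: field_simps)
  qed simp
  then show noise: "L * \<eta>\<^sub>g * \<sigma>\<^sup>2 \<le> \<epsilon> / 8"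
    using mult_left_mono[OF L\<eta>q, of \<epsilon>] \<open>\<epsilon> > 0\<close> by (simp add: \<sigma> mult_ac)
  have L\<eta>n: "L * \<eta>\<^sub>g * real n \<le> 1 / 4"
  proof -
    have "L * \<eta>\<^sub>g \<le> 1 / (4 * real n)" by (simp add: L\<eta>)
    then show ?thesis using n by (simp add: field_simps)
  qed
  have nK: "real (n * K) \<le> q + real n"
    using mult_left_mono[OF K_le, of "real n"] n by (simp add: qn distrib_left)
  then have "L * \<eta>\<^sub>g * real (n * K) \<le> L * \<eta>\<^sub>g * (q + real n)"
    using \<open>L > 0\<close> eta0 by (intro mult_left_mono) auto
  also have "\<dots> \<le> 1 / 2" using L\<eta>q L\<eta>n by (simp add: distrib_left)
  finally show "L * \<eta>\<^sub>g * real (n * K) \<le> 1 / 2" .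
  have b_nK: "b \<le> real (n * K)"
  proof -
    have "q / real n \<le> real K" unfolding K qn by (simp add: le_max_iff_disj) linarith
    then have "q \<le> real (n * K)" using n by (simp add: field_simps)
    moreover have "real n \<le> real (n * K)" using K1 by (simp del: of_nat_mult)
    ultimately show ?thesis by (simp add: b q_def)
  qed
  have "1 / 8 \<le> L * \<eta>\<^sub>g * b"
  proof (cases "q = 0")
    case True
    then show ?thesis using n by (simp add: L\<eta> b q_def[symmetric])
  next
    case False
    then have "1 / (8 * b) \<le> L * \<eta>\<^sub>g"
      using q0 n by (auto simp: L\<eta> b q_def[symmetric] intro!: divide_left_mono)
    then show ?thesis using b0 by (simp add: field_simps)
  qed
  also have "\<dots> \<le> L * \<eta>\<^sub>g * real (n * K)"
    using \<open>L > 0\<close> eta0 b_nK by (intro mult_left_mono) auto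
  finally show "1 / 8 \<le> L * \<eta>\<^sub>g * real (n * K)" .
  note sums = step_sums[OF K1 less_imp_le[OF b0] less_imp_le[OF eta0]]
  have large: "b = q \<and> real (K - 1) \<le> b \<and> 3 / 2 \<le> ln (real K) + 1" if "K \<noteq> 1"
  proof -
    have K2: "K \<ge> 2" using that K1 by simp
    have ceil: "K = nat \<lceil>q / real n\<rceil>" using that unfolding K qn by (simp add: max_def split: if_splits)
    then have gt: "1 < q / real n" using K2 by linarith
    then have qn_less: "real n < q" using n by (simp add: field_simps)
    have "real (K - 1) \<le> q / real n" using K_le K1 by (simp add: qn of_nat_diff)
    also have "\<dots> \<le> q / 1" using \<open>n \<ge> 1\<close> q0 by (intro divide_left_mono) auto
    finally have "real (K - 1) \<le> q" by simp
    moreover have "1 / 2 \<le> ln (real K)"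
    proof -
      have "exp (1 / 2 :: real) \<le> 1 + 1 / 2 + (1 / 2)\<^sup>2" by (rule exp_bound) simp_all
      also have "\<dots> \<le> real K" using K2 by (simp add: power2_eq_square)
      finally show ?thesis using K2 by (subst ln_ge_iff) auto
    qed
    ultimately show ?thesis using qn_less by (simp add: b q_def[symmetric])
  qed
  show "L\<^sup>2 * (\<Sum>l<K - 1. local_step_size \<eta>\<^sub>g b K l)\<^sup>2 \<le> 1 / 24"
  proof (cases "K = 1")
    case False
    note lg = large[OF this]
    have "4 * b * real (K - 1) / (ln (real K) + 1) \<le> 4 * b * b / (3 / 2)"
      using lg b0 by (intro frac_le mult_mono) auto
    then have "(\<Sum>l<K - 1. local_step_size \<eta>\<^sub>g b K l)\<^sup>2 \<le> 4 * b * b / (3 / 2) * \<eta>\<^sub>g\<^sup>2"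
      by (intro order.trans[OF sums(1)] mult_right_mono) simp_all
    then have "L\<^sup>2 * (\<Sum>l<K - 1. local_step_size \<eta>\<^sub>g b K l)\<^sup>2 \<le> L\<^sup>2 * (4 * b * b / (3 / 2) * \<eta>\<^sub>g\<^sup>2)"
      by (rule mult_left_mono) simp
    also have "\<dots> = 8 / 3 * (L * \<eta>\<^sub>g * b)\<^sup>2" by (simp add: power2_eq_square)
    also have "\<dots> \<le> 8 / 3 * (1 / 8)\<^sup>2"
      using lg L\<eta>q \<open>L > 0\<close> eta0 b0 by (intro mult_left_mono power_mono) auto
    also have "\<dots> = 1 / 24" by (simp add: power2_eq_square)
    finally show ?thesis .
  qed simp
  show "L\<^sup>2 * \<sigma>\<^sup>2 * (\<Sum>l<K - 1. (local_step_size \<eta>\<^sub>g b K l)\<^sup>2) \<le> \<epsilon> / 64"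
  proof (cases "K = 1")
    case False
    note lg = large[OF this]
    have "L\<^sup>2 * \<sigma>\<^sup>2 * (\<Sum>l<K - 1. (local_step_size \<eta>\<^sub>g b K l)\<^sup>2) \<le> L\<^sup>2 * \<sigma>\<^sup>2 * (b * \<eta>\<^sub>g\<^sup>2)"
      by (intro mult_left_mono sums(2)) simp
    also have "\<dots> = (L * \<eta>\<^sub>g * b) * (L * \<eta>\<^sub>g * \<sigma>\<^sup>2)" by (simp add: power2_eq_square)
    also have "\<dots> \<le> 1 / 8 * (\<epsilon> / 8)"
      using lg L\<eta>q noise \<open>L > 0\<close> eta0 by (intro mult_mono) auto
    finally show ?thesis by simp
  qed (use \<open>\<epsilon> > 0\<close> in simp)
qed

section \<open>Selecting an iterate and bounding the running time\<close>

text \<open>A uniformly random index turns the average of the second moments over the iterates into one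
  expectation.\<close>

lemma uniform_selection:
  fixes grad :: "'a::euclidean_space \<Rightarrow> 'a"
  assumes M: "prob_space M" and grad: "grad \<in> borel_measurable borel"
    and m: "1 \<le> m" "m \<le> Suc r"
    and X: "\<And>t. t < m \<Longrightarrow> X t \<in> borel_measurable M"
    and int: "\<And>t. t < m \<Longrightarrow> integrable M (\<lambda>\<omega>. (norm (grad (X t \<omega>)))\<^sup>2)"
    and bound: "(\<Sum>t<m. \<integral>\<omega>. (norm (grad (X t \<omega>)))\<^sup>2 \<partial>M) \<le> real m * \<epsilon>"
  shows "finds_eps_stationary M grad \<epsilon> X r"
proof -
  interpret prob_space M by fact
  define Q where "Q = pmf_of_set {..<m}"
  \<comment> \<open>The value \<open>0\<close> outside the support of \<open>Q\<close> keeps every index that \<open>T\<close> returns below \<open>m\<close>, where the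
    iterates are known to be measurable.\<close>
  define T where "T s = (if s < m then s else 0)" for s
  let ?Y = "\<lambda>(s, \<omega>). X (T s) \<omega>"
  have T_less: "T s < m" for s using m by (simp add: T_def)
  have [measurable]: "grad \<in> borel_measurable borel" by fact
  have Y: "?Y \<in> borel_measurable (measure_pmf Q \<Otimes>\<^sub>M M)"
  proof -
    have "?Y \<in> borel_measurable (count_space UNIV \<Otimes>\<^sub>M M)"
      by (rule measurable_pair_measure_countable1) (simp_all add: X T_less)
    moreover have "sets (count_space UNIV \<Otimes>\<^sub>M M) = sets (measure_pmf Q \<Otimes>\<^sub>M M)"
      by (intro sets_pair_measure_cong) simp_all
    ultimately show ?thesis using measurable_cong_sets by blast
  qed
  have "(\<integral>\<^sup>+p. ennreal ((norm (grad (?Y p)))\<^sup>2) \<partial>(measure_pmf Q \<Otimes>\<^sub>M M))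
      = (\<integral>\<^sup>+s. \<integral>\<^sup>+\<omega>. ennreal ((norm (grad (X (T s) \<omega>)))\<^sup>2) \<partial>M \<partial>measure_pmf Q)"
    using Y by (subst nn_integral_fst[symmetric]) simp_all
  also have "\<dots> = (\<integral>\<^sup>+s. ennreal (\<integral>\<omega>. (norm (grad (X (T s) \<omega>)))\<^sup>2 \<partial>M) \<partial>measure_pmf Q)"
    by (simp add: nn_integral_eq_integral int T_less)
  also have "\<dots> = ennreal (\<integral>s. (\<integral>\<omega>. (norm (grad (X (T s) \<omega>)))\<^sup>2 \<partial>M) \<partial>measure_pmf Q)"
    using m by (intro nn_integral_eq_integral integrable_measure_pmf_finite)
       (auto simp: Q_def lessThan_empty_iff intro!: Bochner_Integration.integral_nonneg)
  also have "(\<integral>s. (\<integral>\<omega>. (norm (grad (X (T s) \<omega>)))\<^sup>2 \<partial>M) \<partial>measure_pmf Q)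
      = (\<Sum>t<m. \<integral>\<omega>. (norm (grad (X t \<omega>)))\<^sup>2 \<partial>M) / real m"
    using m by (simp add: Q_def integral_pmf_of_set T_def lessThan_empty_iff)
  also have "\<dots> \<le> \<epsilon>" using bound m by (simp add: field_simps)
  finally have "(\<integral>\<^sup>+p. ennreal ((norm (grad (?Y p)))\<^sup>2) \<partial>(measure_pmf Q \<Otimes>\<^sub>M M)) \<le> ennreal \<epsilon>"
    by (simp add: ennreal_leI)
  moreover have "T s \<le> r" for s
    using T_less[of s] m by simp
  ultimately show ?thesis
    unfolding finds_eps_stationary_def eps_stationary_def using Y by blast
qed

lemma run_time_le:
  assumes "n \<ge> 1" "\<And>t i j. gtime t i j \<le> h" "\<And>t. ctime t \<le> \<tau>"
  shows "run_time n K gtime ctime r \<le> real r * (h * real K + \<tau>)"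
proof -
  have "(MAX i\<in>{1..n}. \<Sum>j<K. gtime t i j) \<le> h * real K" for t
  proof (rule Max.boundedI)
    fix a assume "a \<in> (\<lambda>i. \<Sum>j<K. gtime t i j) ` {1..n}"
    then show "a \<le> h * real K"
      using sum_bounded_above[of "{..<K}" "gtime t _" h] assms(2) by (auto simp: mult.commute)
  qed (use \<open>n \<ge> 1\<close> in auto)
  then have "run_time n K gtime ctime r \<le> (\<Sum>t<r. h * real K + \<tau>)"
    unfolding run_time_def by (intro sum_mono add_mono assms)
  then show ?thesis by simp
qed

theorem theorem4p1:
  fixes L \<epsilon> \<sigma> \<Delta> \<eta>\<^sub>g b :: real
    and n K R :: nat
    and f :: "real ^ 'd \<Rightarrow> real"
    and grad :: "real ^ 'd \<Rightarrow> real ^ 'd"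
    and x0 :: "real ^ 'd"
    and D :: "'x measure"
    and g :: "real ^ 'd \<Rightarrow> 'x \<Rightarrow> real ^ 'd"
    and M :: "'w measure"
    and \<xi> :: "nat \<Rightarrow> nat \<Rightarrow> nat \<Rightarrow> 'w \<Rightarrow> 'x"
  assumes "L > 0" and "\<epsilon> > 0" and "n \<ge> 1"
    and gradient: "\<And>x. GDERIV f x :> grad x"
    and smooth: "\<And>x y. norm (grad x - grad y) \<le> L * norm (x - y)"
    and bounded_below: "bdd_below (range f)"
    and Delta: "\<Delta> = f x0 - (INF x. f x)"
    and prob_D: "prob_space D"
    and g_measurable: "(\<lambda>(x, s). g x s) \<in> borel_measurable (borel \<Otimes>\<^sub>M D)"
    and unbiased: "\<And>x. has_bochner_integral D (g x) (grad x)"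
    and variance: "\<And>x. (\<integral>\<^sup>+ s. ennreal ((norm (g x s - grad x))\<^sup>2) \<partial>D) \<le> ennreal (\<sigma>\<^sup>2)"
    and eta_g: "\<eta>\<^sub>g = (if \<sigma>\<^sup>2 = 0 then 1 / (4 * real n * L)
                    else min (\<epsilon> / (8 * L * \<sigma>\<^sup>2)) (1 / (4 * real n * L)))"
    and b: "b = max (\<sigma>\<^sup>2 / \<epsilon>) (real n)"
    and K: "K = max (nat \<lceil>\<sigma>\<^sup>2 / (\<epsilon> * real n)\<rceil>) 1"
    and R: "R = nat \<lceil>32 * L * \<Delta> / \<epsilon>\<rceil>"
    and prob_M: "prob_space M"
    and indep: "prob_space.indep_vars M (\<lambda>_. D) (\<lambda>(t, i, j). \<xi> t i j) ({..<R} \<times> {1..n} \<times> {..<K})"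
    and law: "\<And>t i j. t < R \<Longrightarrow> i \<in> {1..n} \<Longrightarrow> j < K \<Longrightarrow> distr M D (\<xi> t i j) = D"
  shows "\<exists>r\<le>R.
    finds_eps_stationary M grad \<epsilon>
      (\<lambda>t \<omega>. decaying_local_sgd n K \<eta>\<^sub>g b g x0 (\<lambda>t i j. \<xi> t i j \<omega>) t) r \<and>
    (\<forall>h \<tau> gtime ctime.
       (\<forall>t i j. 0 \<le> gtime t i j \<and> gtime t i j \<le> h) \<longrightarrow>
       (\<forall>t. 0 \<le> ctime t \<and> ctime t \<le> \<tau>) \<longrightarrow>
       run_time n K gtime ctime r
         \<le> \<tau> * (64 * L * \<Delta> / \<epsilon>)
           + 64 * h * (L * \<Delta> / \<epsilon> + L * \<sigma>\<^sup>2 * \<Delta> / (real n * \<epsilon>\<^sup>2)))"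
proof -
  interpret prob_space M by fact
  define \<mu> where "\<mu> = (INF x. f x)"
  define a where "a = L * \<Delta> / \<epsilon>"
  let ?X = "\<lambda>t \<omega>. decaying_local_sgd n K \<eta>\<^sub>g b g x0 (\<lambda>t i j. \<xi> t i j \<omega>) t"
  have sg: "stochastic_gradient M D grad g L (\<sigma>\<^sup>2)"
    by (intro stochastic_gradient.intro stochastic_gradient_axioms.intro prob_M prob_D smooth
        g_measurable unbiased variance \<open>L > 0\<close> zero_le_power2)
  interpret local_sgd M D grad g L "\<sigma>\<^sup>2" \<xi> n K R \<eta>\<^sub>g b x0
    by (intro local_sgd.intro sg local_sgd_axioms.intro indep law)
  note params = parameter_bounds[OF \<open>L > 0\<close> \<open>\<epsilon> > 0\<close> \<open>n \<ge> 1\<close> eta_g b K]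
  have lower: "\<mu> \<le> f x" for x
    unfolding \<mu>_def by (rule cINF_lower[OF bounded_below]) simp
  have \<Delta>0: "0 \<le> \<Delta>" using lower[of x0] by (simp add: Delta \<mu>_def)
  have a0: "0 \<le> a" using \<Delta>0 \<open>L > 0\<close> \<open>\<epsilon> > 0\<close> by (simp add: a_def)
  have R_a: "R = nat \<lceil>32 * a\<rceil>" by (simp add: R a_def mult.assoc)
  have L\<Delta>: "L * \<Delta> = \<epsilon> * a" using \<open>\<epsilon> > 0\<close> by (simp add: a_def)
  \<comment> \<open>The time bound needs \<open>r \<le> 64 * a\<close>, and the rounding in \<open>R\<close> violates this for \<open>r = R\<close> when \<open>a\<close> is
    positive but tiny. For such \<open>a\<close> the starting point is already stationary, without any round.\<close>
  define r where "r = (if 2 * a \<le> 1 then 0 else R)"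
  have r_le: "real r \<le> 64 * a"
  proof (cases "2 * a \<le> 1")
    case True
    then show ?thesis using a0 by (simp add: r_def)
  next
    case False
    then show ?thesis unfolding r_def R_a by simp linarith
  qed
  have iter: "sq_integrable M (?X t)" if "t \<le> R" for t by (rule iter_sq_integrable[OF that])
  have iter_grad: "integrable M (\<lambda>\<omega>. (norm (grad (?X t \<omega>)))\<^sup>2)" if "t \<le> R" for t
    by (rule sq_integrable_norm[OF sq_integrable_grad[OF iter[OF that]]])
  have finds: "finds_eps_stationary M grad \<epsilon> ?X r"
  proof (cases "2 * a \<le> 1")
    case True
    have "(norm (grad x0))\<^sup>2 \<le> 2 * L * \<Delta>"
      using smooth_gradient_bound[OF gradient smooth \<open>L > 0\<close> lower] by (simp add: Delta \<mu>_def)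
    also have "\<dots> = \<epsilon> * (2 * a)" using L\<Delta> by simp
    also have "\<dots> \<le> \<epsilon>" using True \<open>\<epsilon> > 0\<close> by (simp add: mult_left_le)
    finally have "(norm (grad x0))\<^sup>2 \<le> \<epsilon>" .
    then show ?thesis
      by (intro uniform_selection[OF prob_M grad_measurable, of 1]) (simp_all add: prob_space)
  next
    case False
    then have R1: "R \<ge> 1" and R32: "32 * a \<le> real R" unfolding R_a by linarith+
    define \<gamma> where "\<gamma> = \<eta>\<^sub>g * real (n * K)"
    define \<Sigma> where "\<Sigma> = (\<Sum>t<R. expectation (\<lambda>\<omega>. (norm (grad (?X t \<omega>)))\<^sup>2))"
    have \<gamma>: "0 < \<gamma>" using params(1,3) \<open>n \<ge> 1\<close> by (simp add: \<gamma>_def)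
    have \<gamma>L: "1 / 8 \<le> L * \<gamma>" using params(7) by (simp add: \<gamma>_def mult.assoc)
    \<comment> \<open>In units of \<open>\<gamma> * \<epsilon> * R\<close>, the initial gap contributes \<open>1 / 4\<close>, the drift \<open>3 / 160\<close> and the noise
      \<open>1 / 8\<close>; together these stay below the \<open>2 / 5\<close> available.\<close>
    have "\<gamma> * (2 / 5 * \<Sigma>) \<le> \<Delta> + real R * (\<gamma> * (6 / 5 * (\<epsilon> / 64) + L * \<eta>\<^sub>g * \<sigma>\<^sup>2))"
      unfolding \<gamma>_def \<Sigma>_def Delta \<mu>_def[symmetric]
      using params by (intro sum_gradient_bound gradient lower) auto
    also have "\<dots> \<le> \<gamma> * (\<epsilon> * real R / 4) + real R * (\<gamma> * (6 / 5 * (\<epsilon> / 64) + \<epsilon> / 8))"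
    proof (intro add_mono mult_left_mono)
      have "L * \<Delta> * 1 \<le> L * \<Delta> * (8 * (L * \<gamma>))"
        using \<gamma>L \<Delta>0 \<open>L > 0\<close> by (intro mult_left_mono) auto
      then have "\<Delta> \<le> \<gamma> * (8 * (L * \<Delta>))" using \<open>L > 0\<close> by (simp add: mult_ac)
      also have "\<dots> \<le> \<gamma> * (\<epsilon> * real R / 4)"
        using mult_left_mono[OF R32, of \<epsilon>] \<open>\<epsilon> > 0\<close> \<gamma> unfolding L\<Delta> by (intro mult_left_mono) auto
      finally show "\<Delta> \<le> \<gamma> * (\<epsilon> * real R / 4)" .
    qed (use params(5) \<gamma> in auto)
    also have "\<dots> = \<gamma> * (2 / 5 * (63 / 64 * (\<epsilon> * real R)))" by (simp add: field_simps)
    finally have "\<Sigma> \<le> 63 / 64 * (\<epsilon> * real R)" using \<gamma> by simp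
    also have "\<dots> \<le> real R * \<epsilon>" using \<open>\<epsilon> > 0\<close> by simp
    finally have "\<Sigma> \<le> real R * \<epsilon>" .
    then show ?thesis
      using False R1 iter
      by (intro uniform_selection[OF prob_M grad_measurable, of R])
         (auto simp: \<Sigma>_def r_def intro: sq_integrable_measurable iter_grad)
  qed
  have time: "run_time n K gtime ctime r
         \<le> \<tau> * (64 * L * \<Delta> / \<epsilon>)
           + 64 * h * (L * \<Delta> / \<epsilon> + L * \<sigma>\<^sup>2 * \<Delta> / (real n * \<epsilon>\<^sup>2))"
    if g: "\<forall>t i j. 0 \<le> gtime t i j \<and> gtime t i j \<le> h" and c: "\<forall>t. 0 \<le> ctime t \<and> ctime t \<le> \<tau>"
    for h \<tau> gtime ctime
  proof -
    have "0 \<le> h" "0 \<le> \<tau>" using g c order.trans by blast+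
    have "run_time n K gtime ctime r \<le> real r * (h * real K + \<tau>)"
      using g c by (intro run_time_le \<open>n \<ge> 1\<close>) auto
    also have "\<dots> \<le> 64 * a * (h * (1 + \<sigma>\<^sup>2 / (\<epsilon> * real n)) + \<tau>)"
      using \<open>0 \<le> h\<close> \<open>0 \<le> \<tau>\<close> params(4) r_le a0 by (intro mult_mono add_mono mult_left_mono) auto
    also have "\<dots> = \<tau> * (64 * L * \<Delta> / \<epsilon>)
           + 64 * h * (L * \<Delta> / \<epsilon> + L * \<sigma>\<^sup>2 * \<Delta> / (real n * \<epsilon>\<^sup>2))"
      using \<open>\<epsilon> > 0\<close> \<open>n \<ge> 1\<close> by (simp add: a_def field_simps power2_eq_square)
    finally show ?thesis .
  qed
  have "r \<le> R" by (simp add: r_def)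
  with finds time show ?thesis by blast
qed

end
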